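(* Let $c=1$, $\lambda_1,\lambda_2,\mu_1,\mu_2>0$, let $X$ be the Markov chain described in the context with $X(0)=(0,0)$, and fix $\alpha$ with $\mathrm{Re}\,\alpha>0$. Then for every $i\ge0$, $$\pi_{(i+1,0)}(\alpha)=\lambda_1\pi_{(i,0)}(\alpha)N(\alpha)+\lambda_2\sum_{k=0}^{i}\pi_{(k,0)}(\alpha)G(\alpha)^{k-(i+1)}\Bigl(\phi_{\lambda_2,\mu_2}\bigl(\lambda_1(1-G(\alpha))+\alpha\bigr)-\sum_{l=0}^{i-k}w^{\lambda_2,\mu_2,\lambda_1}_l(\alpha)G(\alpha)^l\Bigr)N(\alpha).$$
   Context: With $c=1$, the Markov chain $X$ on $\mathbb{N}_0^2$ has only nonzero off-diagonal rates $q((i,j),(i+1,j))=\lambda_1$, $q((i,j),(i,j+1))=\lambda_2$ ($i,j\ge0$), $q((i,0),(i-1,0))=\mu_1$ ($i\ge1$), $q((i,j),(i,j-1))=\mu_2$ ($j\ge1$). $\pi_x(\alpha)=\int_0^\infty e^{-\alpha t}P(X(t)=x\mid X(0)=(0,0))\,dt$. For $A\subset\mathbb{N}_0^2$, $\tau_A=\inf\{t>0:X(t^-)\ne X(t)\in A\}$; $E_z$ is expectation given $X(0)=z$. $G(\alpha)=E_{(i+1,0)}[e^{-\alpha\tau_{\{(i,0)\}}}]$ and $N(\alpha)=E_{(i,0)}\bigl[\int_0^{\tau_{\{(i-1,0)\}}}e^{-\alpha t}\mathbf{1}\{X(t)=(i,0)\}\,dt\bigr]$, both independent of $i\ge1$.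 For $\lambda',\mu'>0$, $\phi_{\lambda',\mu'}(s)=\frac{\lambda'+\mu'+s-\sqrt{(\lambda'+\mu'+s)^2-4\lambda'\mu'}}{2\lambda'}$ is the Laplace–Stieltjes transform of the busy period $B$ of an $M/M/1$ queue (arrival rate $\lambda'$, service rate $\mu'$) started by one customer, and for $\theta>0$, $w^{\lambda',\mu',\theta}_l(\alpha)=E[e^{-\alpha B}\mathbf{1}\{\Lambda_\theta(B)=l\}]$ where $\Lambda_\theta$ is an independent Poisson process of rate $\theta$. *)

theory Defs
  imports "HOL-Probability.Probability"
begin

definition qout :: "('b \<Rightarrow> 'b \<Rightarrow> real) \<Rightarrow> 'b \<Rightarrow> real" where
  "qout q x = (\<Sum>\<^sub>\<infinity>y\<in>UNIV - {x}. q x y)"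

text \<open>(M, Y, T) realises the CTMC with rates q started in z: Y is the jump chain,
  T n the holding time in state Y n. Their joint law is prescribed on all finite
  prefixes: jumps with probabilities q(x,y)/qout(x), independent exponential
  holding times with rate qout(x).\<close>
definition jump_chain_law ::
  "('b \<Rightarrow> 'b \<Rightarrow> real) \<Rightarrow> 'a measure \<Rightarrow> (nat \<Rightarrow> 'a \<Rightarrow> 'b) \<Rightarrow> (nat \<Rightarrow> 'a \<Rightarrow> real) \<Rightarrow> 'b \<Rightarrow> bool" where
  "jump_chain_law q M Y T z \<longleftrightarrow>
     prob_space M \<and>
     (\<forall>n. Y n \<in> measurable M (count_space UNIV)) \<and>
     (\<forall>n. T n \<in> borel_measurable M) \<and>
     (\<forall>n (ys :: nat \<Rightarrow> 'b) (s :: nat \<Rightarrow> real). (\<forall>k<n. 0 \<le> s k) \<longrightarrow>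
        measure M {\<omega> \<in> space M. (\<forall>k\<le>n. Y k \<omega> = ys k) \<and> (\<forall>k<n. s k < T k \<omega>)} =
        (if ys 0 = z then
           (\<Prod>k<n. q (ys k) (ys (Suc k)) / qout q (ys k) * exp (- qout q (ys k) * s k))
         else 0))"

definition ctmc_X :: "(nat \<Rightarrow> 'a \<Rightarrow> 'b) \<Rightarrow> (nat \<Rightarrow> 'a \<Rightarrow> real) \<Rightarrow> real \<Rightarrow> 'a \<Rightarrow> 'b" where
  "ctmc_X Y T t \<omega> = Y (LEAST n. t < (\<Sum>k\<le>n. T k \<omega>)) \<omega>"

definition hit_time :: "(nat \<Rightarrow> 'a \<Rightarrow> 'b::t2_space) \<Rightarrow> (nat \<Rightarrow> 'a \<Rightarrow> real) \<Rightarrow> 'b set \<Rightarrow> 'a \<Rightarrow> ereal" where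
  "hit_time Y T A \<omega> = Inf (ereal ` {t. 0 < t \<and>
      Lim (at_left t) (\<lambda>s. ctmc_X Y T s \<omega>) \<noteq> ctmc_X Y T t \<omega> \<and> ctmc_X Y T t \<omega> \<in> A})"

definition disc :: "complex \<Rightarrow> ereal \<Rightarrow> complex" where
  "disc \<alpha> \<tau> = (if \<tau> = \<infinity> then 0 else exp (- \<alpha> * of_real (real_of_ereal \<tau>)))"

definition rateX :: "real \<Rightarrow> real \<Rightarrow> real \<Rightarrow> real \<Rightarrow> nat \<times> nat \<Rightarrow> nat \<times> nat \<Rightarrow> real" where
  "rateX l1 l2 m1 m2 x y =
     (let (i, j) = x in
      if y = (i + 1, j) then l1
      else if y = (i, j + 1) then l2
      else if j = 0 \<and> 1 \<le> i \<and> y = (i - 1, 0) then m1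
      else if 1 \<le> j \<and> y = (i, j - 1) then m2
      else 0)"

text \<open>pi_x(alpha) for the chain started in (0,0) (law M).\<close>
definition piX :: "'a measure \<Rightarrow> (nat \<Rightarrow> 'a \<Rightarrow> nat \<times> nat) \<Rightarrow> (nat \<Rightarrow> 'a \<Rightarrow> real) \<Rightarrow> nat \<times> nat \<Rightarrow> complex \<Rightarrow> complex" where
  "piX M Y T x \<alpha> = set_lebesgue_integral lborel {0..}
     (\<lambda>t. exp (- \<alpha> * of_real t) * of_real (measure M {\<omega> \<in> space M. ctmc_X Y T t \<omega> = x}))"

text \<open>G(alpha) = E_{(i+1,0)}[e^{-alpha tau_{(i,0)}}], taken at i = 1 (independent of i \<ge> 1).\<close>
definition GX :: "'a measure \<Rightarrow> (nat \<Rightarrow> 'a \<Rightarrow> nat \<times> nat) \<Rightarrow> (nat \<Rightarrow> 'a \<Rightarrow> real) \<Rightarrow> complex \<Rightarrow> complex" where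
  "GX M Y T \<alpha> = integral\<^sup>L M (\<lambda>\<omega>. disc \<alpha> (hit_time Y T {(1, 0)} \<omega>))"

text \<open>N(alpha) = E_{(i,0)}[int_0^{tau_{(i-1,0)}} e^{-alpha t} 1{X(t)=(i,0)} dt], taken at i = 1.\<close>
definition NX :: "'a measure \<Rightarrow> (nat \<Rightarrow> 'a \<Rightarrow> nat \<times> nat) \<Rightarrow> (nat \<Rightarrow> 'a \<Rightarrow> real) \<Rightarrow> complex \<Rightarrow> complex" where
  "NX M Y T \<alpha> = integral\<^sup>L M (\<lambda>\<omega>.
      set_lebesgue_integral lborel {t. 0 \<le> t \<and> ereal t < hit_time Y T {(0, 0)} \<omega>}
        (\<lambda>t. exp (- \<alpha> * of_real t) * (if ctmc_X Y T t \<omega> = (1, 0) then 1 else 0)))"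

definition phi :: "real \<Rightarrow> real \<Rightarrow> complex \<Rightarrow> complex" where
  "phi l m s = (of_real l + of_real m + s - csqrt ((of_real l + of_real m + s)^2 - 4 * of_real l * of_real m))
                / (2 * of_real l)"

definition rateMM1 :: "real \<Rightarrow> real \<Rightarrow> nat \<Rightarrow> nat \<Rightarrow> real" where
  "rateMM1 l m n k = (if k = Suc n then l else if n = Suc k then m else 0)"

text \<open>w_l(alpha) = E[e^{-alpha B} 1{Lambda_theta(B) = l}], B the busy period (tau_{0} of the
  queue-length chain started with one customer, law M), Lambda_theta an independent
  Poisson process: conditionally on B, P(Lambda_theta(B) = l) = e^{-theta B}(theta B)^l/l!.\<close>
definition wB :: "'a measure \<Rightarrow> (nat \<Rightarrow> 'a \<Rightarrow> nat) \<Rightarrow> (nat \<Rightarrow> 'a \<Rightarrow> real) \<Rightarrow> real \<Rightarrow> nat \<Rightarrow> complex \<Rightarrow> complex" where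
  "wB M Y T \<theta> l \<alpha> = integral\<^sup>L M (\<lambda>\<omega>.
      let B = hit_time Y T {0} \<omega> in
      disc \<alpha> B * of_real (exp (- \<theta> * real_of_ereal B) * (\<theta> * real_of_ereal B) ^ l / fact l))"

end

theory Submission
  imports Defs
begin

text \<open>The law of the jump chain gives, on each finite path, the transform of the jump times as a product of
  factors \<open>q x y / (a + qout q x)\<close>. For bounded \<open>f\<close> this yields Dynkin's formula: with
  \<open>h = (a - Q) f\<close>, the value \<open>f z\<close> is the expected discounted integral of \<open>h\<close> along the path up to a
  hitting time plus the discounted value of \<open>f\<close> at that time. Everything else is the choice of \<open>f\<close>.

  Powers of \<open>phi\<close> give the transform of the busy period. Brouwer's theorem gives a solution \<open>g\<close> in the
  unit disc of the fixed point equation expected of \<open>G\<close>, and functions of the form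
  \<open>g ^ k * phi ^ j\<close> then identify \<open>G = g\<close> and \<open>N = g / m1\<close>.
  Finally let \<open>f x\<close> be the discounted time spent in \<open>(i + 1, 0)\<close> before hitting \<open>{(k, 0) | k \<le> i}\<close>.
  Then \<open>(a - Q) f\<close> is supported on \<open>{(k, 0) | k \<le> i + 1}\<close>, and Dynkin's formula for the chain
  started in \<open>(0, 0)\<close>, where \<open>f\<close> vanishes, is the claimed recursion.\<close>

section \<open>Exponential integrals\<close>

text \<open>The chain is given by the law of its finite prefixes, and the path is never cut at a
  hitting time by a strong Markov property. Dynkin's formula takes over: a bounded function with the
  right resolvent equation is guessed, and its value at the start must then be the wanted
  expectation.

  As \<alpha> is complex, \<open>G\<close> cannot be singled out as a minimal positive solution. Any
  solution of its equation in the closed unit disc will do: the identification \<open>G = g\<close>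
  yields uniqueness afterwards, so Brouwer's bare existence suffices. The equation also forces
  \<open>g \<noteq> 0\<close>, which gives the negative powers a meaning.

  From \<open>(k, j)\<close> the path returns to the axis after \<open>j\<close> class 2 busy
  periods, with the class 1 arrivals counted meanwhile. Instead of proving independence, the joint
  weights are defined as coefficients of the \<open>j\<close>-th power of the power series of
  \<open>w\<close>; the quadratic equation of \<open>phi\<close>, read coefficientwise, is then the
  resolvent equation. The truncated sum in the claim appears because at most \<open>i - k\<close>
  arrivals lead to a state where the function is zero.\<close>

lemma integrable_exp_neg_mult_Ici:
  fixes a :: complex
  assumes "0 < Re a"
  shows "set_integrable lborel {0..} (\<lambda>t. exp (- a * of_real t))"
proof -
  interpret E: prob_space "density lborel (exponential_density (Re a))"
    using assms by (rule prob_space_exponential_density)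
  have "(\<integral>\<^sup>+ t. ennreal (exponential_density (Re a) t) \<partial>lborel) = 1"
    using E.emeasure_space_1 by (simp add: emeasure_density)
  hence "integrable lborel (exponential_density (Re a))"
    using assms by (intro integrableI_nonneg) (auto intro!: AE_I2 exponential_density_nonneg)
  hence "integrable lborel (\<lambda>t. exponential_density (Re a) t / Re a)"
    by (rule integrable_divide_zero)
  hence "integrable lborel (\<lambda>t. indicator {0..} t *\<^sub>R exp (- a * of_real t))"
  proof (rule Bochner_Integration.integrable_bound)
    show "AE t in lborel. norm (indicator {0..} t *\<^sub>R exp (- a * of_real t)) \<le> norm (exponential_density (Re a) t / Re a)"
      using assms by (intro AE_I2) (auto simp: norm_exp_eq_Re exponential_density_def indicator_def mult.commute)
  qed measurable
  thus ?thesis unfolding set_integrable_def .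
qed

lemma set_integral_Icc_eq_Ico:
  fixes f :: "real \<Rightarrow> complex"
  assumes [measurable]: "f \<in> borel_measurable borel"
  shows "(LINT t:{x..y}|lborel. f t) = (LINT t:{x..<y}|lborel. f t)"
  unfolding set_lebesgue_integral_def
  by (rule integral_cong_AE) (use AE_lborel_singleton[of y] in \<open>auto simp: indicator_def elim!: eventually_mono\<close>)

lemma set_integral_exp_neg_mult_Ico:
  fixes a :: complex
  assumes "a \<noteq> 0" "x \<le> y"
  shows "(LINT t:{x..<y}|lborel. exp (- a * of_real t)) = (exp (- a * of_real x) - exp (- a * of_real y)) / a"
proof -
  have *: "(LBINT t. indicator {x..y} t *\<^sub>R exp (- a * of_real t)) = - exp (- a * of_real y) / a - (- exp (- a * of_real x) / a)"
    using assms
    by (intro integral_FTC_Icc[where F="\<lambda>t. - exp (- a * of_real t) / a"])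
       (auto intro!: derivative_eq_intros continuous_intros has_vector_derivative_real_field)
  have "(LINT t:{x..<y}|lborel. exp (- a * of_real t)) = (LINT t:{x..y}|lborel. exp (- a * of_real t))"
    by (rule set_integral_Icc_eq_Ico[symmetric]) measurable
  thus ?thesis using * by (simp add: set_lebesgue_integral_def diff_divide_distrib)
qed

lemma set_integral_exp_neg_mult_Ici:
  fixes a :: complex
  assumes "0 < Re a"
  shows "(LINT t:{0..}|lborel. exp (- a * of_real t)) = 1 / a"
proof -
  have [simp]: "a \<noteq> 0" using assms by auto
  have lim1: "((\<lambda>y. LINT t:{0..y}|lborel. exp (- a * of_real t)) \<longlongrightarrow> (LINT t:{0..}|lborel. exp (- a * of_real t))) at_top"
    by (rule tendsto_set_lebesgue_integral_at_top[OF _ integrable_exp_neg_mult_Ici[OF assms]]) auto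
  have eq: "(LINT t:{0..y}|lborel. exp (- a * of_real t)) = (1 - exp (- a * of_real y)) / a" if "0 \<le> y" for y
  proof -
    have "(LINT t:{0..y}|lborel. exp (- a * of_real t)) = (LINT t:{0..<y}|lborel. exp (- a * of_real t))"
      by (rule set_integral_Icc_eq_Ico) measurable
    thus ?thesis using set_integral_exp_neg_mult_Ico[of a 0 y] that by simp
  qed
  have "((\<lambda>y. exp (- a * of_real y)) \<longlongrightarrow> 0) at_top"
  proof (rule tendsto_norm_zero_cancel)
    show "((\<lambda>y. norm (exp (- a * of_real y))) \<longlongrightarrow> 0) at_top"
      unfolding norm_exp_eq_Re using assms by simp real_asymp
  qed
  hence "((\<lambda>y. (1 - exp (- a * of_real y)) / a) \<longlongrightarrow> (1 - 0) / a) at_top"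
    by (intro tendsto_divide tendsto_diff tendsto_const) auto
  hence "((\<lambda>y. LINT t:{0..y}|lborel. exp (- a * of_real t)) \<longlongrightarrow> (1 - 0) / a) at_top"
    by (rule Lim_transform_eventually)
       (use eq in \<open>auto intro!: eventually_at_top_linorderI[of 0]\<close>)
  with lim1 show ?thesis using tendsto_unique[OF _ lim1] by (simp add: trivial_limit_at_top_linorder)
qed

lemma (in prob_space) expectation_mult_exp_of_exponential_tail:
  fixes W :: "'a \<Rightarrow> complex" and X :: "'a \<Rightarrow> real" and a c :: complex
  assumes [measurable]: "W \<in> borel_measurable M" "X \<in> borel_measurable M"
    and W: "AE \<omega> in M. norm (W \<omega>) \<le> B" and X: "AE \<omega> in M. 0 < X \<omega>"
    and tail: "\<And>s. 0 \<le> s \<Longrightarrow> expectation (\<lambda>\<omega>. W \<omega> * indicator {\<omega>. s < X \<omega>} \<omega>) = c * exp (- of_real (r * s))"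
    and "0 \<le> r" "0 < Re a"
  shows "expectation (\<lambda>\<omega>. W \<omega> * exp (- a * of_real (X \<omega>))) = c * (of_real r / (a + of_real r))"
proof -
  \<comment> \<open>Fubini, applied to \<open>exp (- a X) = 1 - (\<integral>s\<in>{0..<X}. a * exp (- a s))\<close>.\<close>
  interpret L: pair_sigma_finite lborel M ..
  have [simp]: "a \<noteq> 0" using assms by auto
  have ar: "a + of_real r \<noteq> 0"
  proof
    assume "a + of_real r = 0"
    hence "Re a + r = 0" by (auto simp: complex_eq_iff)
    thus False using assms by simp
  qed
  have intW: "integrable M W"
    using W by (rule integrable_const_bound) measurable
  have intWe: "integrable M (\<lambda>\<omega>. W \<omega> * exp (- a * of_real (X \<omega>)))"
  proof (rule Bochner_Integration.integrable_bound[OF intW])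
    show "AE \<omega> in M. norm (W \<omega> * exp (- a * of_real (X \<omega>))) \<le> norm (W \<omega>)"
      using X by eventually_elim
        (use \<open>0 < Re a\<close> in \<open>auto simp: norm_mult norm_exp_eq_Re intro!: mult_right_le_one_le\<close>)
  qed measurable
  define h where "h s \<omega> = indicator {0..} s *\<^sub>R (a * exp (- a * of_real s)) * (W \<omega> * indicator {\<omega>. s < X \<omega>} \<omega>)" for s \<omega>
  have [measurable]: "case_prod h \<in> borel_measurable (lborel \<Otimes>\<^sub>M M)"
    unfolding h_def by measurable
  have hnorm: "norm (h s \<omega>) \<le> norm (indicator {0..} s *\<^sub>R (a * exp (- a * of_real s))) * norm (W \<omega>)" for s \<omega>
    unfolding h_def by (auto simp: indicator_def norm_mult)
  have inte: "integrable lborel (\<lambda>s. indicator {0..} s *\<^sub>R (a * exp (- a * of_real s)))"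
    using integrable_mult_right[OF integrable_exp_neg_mult_Ici[OF \<open>0 < Re a\<close>, unfolded set_integrable_def], of a]
    by (simp add: mult_ac)
  have "integrable (lborel \<Otimes>\<^sub>M M) (case_prod h)"
  proof (rule L.Fubini_integrable)
    show "AE s in lborel. integrable M (\<lambda>\<omega>. case_prod h (s, \<omega>))"
    proof (rule AE_I2)
      fix s :: real
      show "integrable M (\<lambda>\<omega>. case_prod h (s, \<omega>))"
      proof (rule Bochner_Integration.integrable_bound)
        show "integrable M (\<lambda>\<omega>. norm (indicator {0..} s *\<^sub>R (a * exp (- a * of_real s))) * norm (W \<omega>))"
          by (rule integrable_mult_right[OF integrable_norm[OF intW]])
        show "AE \<omega> in M. norm (case_prod h (s, \<omega>)) \<le>
            norm (norm (indicator {0..} s *\<^sub>R (a * exp (- a * of_real s))) * norm (W \<omega>))"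
          using hnorm[of s] by (intro AE_I2) (simp only: prod.case real_norm_def abs_mult abs_norm_cancel)
      qed measurable
    qed
    show "integrable lborel (\<lambda>s. \<integral>\<omega>. norm (case_prod h (s, \<omega>)) \<partial>M)"
    proof (rule Bochner_Integration.integrable_bound[OF integrable_mult_left[OF integrable_norm[OF inte], of "\<integral>\<omega>. norm (W \<omega>) \<partial>M"]])
      show "AE s in lborel. norm (\<integral>\<omega>. norm (case_prod h (s, \<omega>)) \<partial>M)
         \<le> norm (norm (indicator {0..} s *\<^sub>R (a * exp (- a * of_real s))) * (\<integral>\<omega>. norm (W \<omega>) \<partial>M))"
      proof (rule AE_I2)
        fix s :: real
        have "(\<integral>\<omega>. norm (h s \<omega>) \<partial>M) \<le> (\<integral>\<omega>. norm (indicator {0..} s *\<^sub>R (a * exp (- a * of_real s))) * norm (W \<omega>) \<partial>M)"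
          by (rule integral_mono') (use intW hnorm in auto)
        thus "norm (\<integral>\<omega>. norm (case_prod h (s, \<omega>)) \<partial>M)
         \<le> norm (norm (indicator {0..} s *\<^sub>R (a * exp (- a * of_real s))) * (\<integral>\<omega>. norm (W \<omega>) \<partial>M))"
          by simp
      qed
    qed measurable
  qed measurable
  hence swap: "(\<integral>s. (\<integral>\<omega>. h s \<omega> \<partial>M) \<partial>lborel) = (\<integral>\<omega>. (\<integral>s. h s \<omega> \<partial>lborel) \<partial>M)"
    by (rule L.Fubini_integral[symmetric])
  have "(\<integral>s. (\<integral>\<omega>. h s \<omega> \<partial>M) \<partial>lborel) = (\<integral>s. a * c * (indicator {0..} s *\<^sub>R exp (- (a + of_real r) * of_real s)) \<partial>lborel)"
  proof (rule Bochner_Integration.integral_cong)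
    fix s :: real
    show "(\<integral>\<omega>. h s \<omega> \<partial>M) = a * c * (indicator {0..} s *\<^sub>R exp (- (a + of_real r) * of_real s))"
      unfolding h_def using tail[of s]
      by (auto simp: indicator_def algebra_simps exp_diff exp_minus exp_add divide_simps)
  qed simp
  also have "\<dots> = a * c / (a + of_real r)"
    using set_integral_exp_neg_mult_Ici[of "a + of_real r"] assms
    unfolding set_lebesgue_integral_def integral_mult_right_zero by simp
  finally have 1: "(\<integral>s. (\<integral>\<omega>. h s \<omega> \<partial>M) \<partial>lborel) = a * c / (a + of_real r)" .
  have "(\<integral>\<omega>. (\<integral>s. h s \<omega> \<partial>lborel) \<partial>M) = (\<integral>\<omega>. W \<omega> - W \<omega> * exp (- a * of_real (X \<omega>)) \<partial>M)"
  proof (rule integral_cong_AE)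
    show "AE \<omega> in M. (\<integral>s. h s \<omega> \<partial>lborel) = W \<omega> - W \<omega> * exp (- a * of_real (X \<omega>))"
      using X
    proof eventually_elim
      case (elim \<omega>)
      have "(\<integral>s. h s \<omega> \<partial>lborel) = (\<integral>s. a * W \<omega> * (indicator {0..<X \<omega>} s *\<^sub>R exp (- a * of_real s)) \<partial>lborel)"
        by (rule Bochner_Integration.integral_cong) (auto simp: h_def indicator_def)
      also have "\<dots> = a * W \<omega> * ((1 - exp (- a * of_real (X \<omega>))) / a)"
        using set_integral_exp_neg_mult_Ico[of a 0 "X \<omega>"] elim
        unfolding set_lebesgue_integral_def integral_mult_right_zero by simp
      also have "\<dots> = W \<omega> - W \<omega> * exp (- a * of_real (X \<omega>))"
        by (subst times_divide_eq_right) (simp add: divide_simps algebra_simps)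
      finally show ?case .
    qed
  qed measurable
  also have "\<dots> = (\<integral>\<omega>. W \<omega> \<partial>M) - (\<integral>\<omega>. W \<omega> * exp (- a * of_real (X \<omega>)) \<partial>M)"
    by (rule Bochner_Integration.integral_diff[OF intW intWe])
  \<comment> \<open>\<open>X\<close> is positive almost everywhere, so the tail hypothesis at
    \<open>s = 0\<close> identifies \<open>c\<close> as the expectation of \<open>W\<close>.\<close>
  also have "(\<integral>\<omega>. W \<omega> \<partial>M) = (\<integral>\<omega>. W \<omega> * indicator {\<omega>. 0 < X \<omega>} \<omega> \<partial>M)"
    by (rule integral_cong_AE) (use X in \<open>auto elim!: eventually_mono\<close>)
  also have "\<dots> = c" using tail[of 0] by simp
  finally have "c - (\<integral>\<omega>. W \<omega> * exp (- a * of_real (X \<omega>)) \<partial>M) = a * c / (a + of_real r)"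
    using 1 swap by simp
  thus ?thesis using ar by (simp add: field_simps)
qed

section \<open>Paths and hitting times\<close>

lemma ctmc_X_eqI:
  assumes "t < (\<Sum>k\<le>n. T k \<omega>)" "\<And>m. m < n \<Longrightarrow> (\<Sum>k\<le>m. T k \<omega>) \<le> t"
  shows "ctmc_X Y T t \<omega> = Y n \<omega>"
proof -
  have "(LEAST n. t < (\<Sum>k\<le>n. T k \<omega>)) = n"
    using assms by (intro Least_equality) (auto simp: not_less[symmetric])
  thus ?thesis by (simp add: ctmc_X_def)
qed

text \<open>No index qualifies, so \<open>LEAST\<close> is applied to the empty predicate. Its value
  is unspecified but independent of \<open>t\<close>: the path is constant after an
  explosion.\<close>

lemma ctmc_X_explosion:
  assumes "\<And>n. (\<Sum>k\<le>n. T k \<omega>) \<le> t"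
  shows "ctmc_X Y T t \<omega> = Y (LEAST n. False) \<omega>"
proof -
  have "(\<lambda>n. t < (\<Sum>k\<le>n. T k \<omega>)) = (\<lambda>n. False)" using assms by (auto simp: fun_eq_iff not_less)
  thus ?thesis by (simp add: ctmc_X_def)
qed

text \<open>Holding times may be negative here and partial sums need not increase, so the state at
  time \<open>t\<close> is described by the first partial sum exceeding \<open>t\<close>.\<close>

lemma ctmc_X_cases:
  fixes t :: real and T :: "nat \<Rightarrow> 'a \<Rightarrow> real"
  obtains (alive) n where "t < (\<Sum>k\<le>n. T k \<omega>)" "\<And>m. m < n \<Longrightarrow> (\<Sum>k\<le>m. T k \<omega>) \<le> t"
  | (exploded) "\<And>n. (\<Sum>k\<le>n. T k \<omega>) \<le> t"
proof (cases "\<exists>n. t < (\<Sum>k\<le>n. T k \<omega>)")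
  case True
  let ?P = "\<lambda>n. t < (\<Sum>k\<le>n. T k \<omega>)"
  from True have "?P (Least ?P)" by (rule LeastI_ex[of ?P])
  moreover have "(\<Sum>k\<le>m. T k \<omega>) \<le> t" if "m < Least ?P" for m
    using not_less_Least[OF that] by simp
  ultimately show ?thesis by (rule alive)
next
  case False
  thus ?thesis by (intro exploded) (auto simp: not_less)
qed

text \<open>The least index with partial sum above \<open>t\<close> stays the least one until time
  reaches that partial sum; no sign condition on the holding times enters.\<close>

lemma ctmc_X_right_constant:
  obtains e where "0 < e" "\<And>s. t \<le> s \<Longrightarrow> s < t + e \<Longrightarrow> ctmc_X Y T s \<omega> = ctmc_X Y T t \<omega>"
proof (cases rule: ctmc_X_cases[of t T \<omega>])
  case (alive n)
  show ?thesis
  proof (rule that[of "(\<Sum>k\<le>n. T k \<omega>) - t"])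
    fix s assume s: "t \<le> s" "s < t + ((\<Sum>k\<le>n. T k \<omega>) - t)"
    have "(\<Sum>k\<le>m. T k \<omega>) \<le> s" if "m < n" for m using alive(2)[OF that] s by simp
    with s alive show "ctmc_X Y T s \<omega> = ctmc_X Y T t \<omega>"
      by (subst (1 2) ctmc_X_eqI[where n = n]) auto
  qed (use alive in auto)
next
  case exploded
  show ?thesis
  proof (rule that[of 1])
    fix s assume s: "t \<le> s"
    with exploded have "(\<Sum>k\<le>m. T k \<omega>) \<le> s" for m by (rule order.trans)
    thus "ctmc_X Y T s \<omega> = ctmc_X Y T t \<omega>"
      using exploded by (simp add: ctmc_X_explosion)
  qed auto
qed

text \<open>A left limit tested at rational times on countably many windows, so that the predicate
  is measurable in the sample point. Right-constancy of paths recovers the real times.\<close>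

definition left_const :: "(nat \<Rightarrow> 'a \<Rightarrow> 'b) \<Rightarrow> (nat \<Rightarrow> 'a \<Rightarrow> real) \<Rightarrow> real \<Rightarrow> 'a \<Rightarrow> 'b \<Rightarrow> bool" where
  "left_const Y T t \<omega> x \<longleftrightarrow> (\<exists>k::nat. \<forall>r::rat. t - inverse (real (Suc k)) < of_rat r \<longrightarrow> of_rat r < t \<longrightarrow>
     ctmc_X Y T (of_rat r) \<omega> = x)"

lemma tendsto_at_left_discrete:
  fixes g :: "real \<Rightarrow> 'b :: topological_space"
  assumes "open {x}"
  shows "(g \<longlongrightarrow> x) (at_left t) \<longleftrightarrow> (\<exists>b<t. \<forall>s. b < s \<longrightarrow> s < t \<longrightarrow> g s = x)"
proof -
  have "(g \<longlongrightarrow> x) (at_left t) \<longleftrightarrow> eventually (\<lambda>s. g s = x) (at_left t)"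
  proof
    assume "(g \<longlongrightarrow> x) (at_left t)"
    from topological_tendstoD[OF this assms] show "eventually (\<lambda>s. g s = x) (at_left t)" by simp
  qed (rule tendsto_eventually)
  thus ?thesis by (simp add: eventually_at_left_field)
qed

lemma tendsto_at_left_iff_left_const:
  fixes Y :: "nat \<Rightarrow> 'a \<Rightarrow> 'b :: topological_space"
  assumes "open {x}"
  shows "((\<lambda>s. ctmc_X Y T s \<omega>) \<longlongrightarrow> x) (at_left t) \<longleftrightarrow> left_const Y T t \<omega> x"
  unfolding tendsto_at_left_discrete[OF assms]
proof safe
  fix b assume b: "b < t" "\<forall>s. b < s \<longrightarrow> s < t \<longrightarrow> ctmc_X Y T s \<omega> = x"
  then obtain k :: nat where "inverse (real (Suc k)) < t - b"
    using reals_Archimedean[of "t - b"] by auto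
  thus "left_const Y T t \<omega> x"
    using b unfolding left_const_def by (intro exI[of _ k]) auto
next
  assume "left_const Y T t \<omega> x"
  then obtain k :: nat where k: "\<And>r :: rat. t - inverse (real (Suc k)) < of_rat r \<Longrightarrow> of_rat r < t \<Longrightarrow> ctmc_X Y T (of_rat r) \<omega> = x"
    unfolding left_const_def by blast
  show "\<exists>b<t. \<forall>s. b < s \<longrightarrow> s < t \<longrightarrow> ctmc_X Y T s \<omega> = x"
  proof (intro exI conjI allI impI)
    fix s assume s: "t - inverse (real (Suc k)) < s" "s < t"
    obtain e where e: "0 < e" "\<And>s'. s \<le> s' \<Longrightarrow> s' < s + e \<Longrightarrow> ctmc_X Y T s' \<omega> = ctmc_X Y T s \<omega>"
      using ctmc_X_right_constant[of s Y T \<omega>] by metis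
    \<comment> \<open>A rational time inside the interval after \<open>s\<close> on which the path
      is constant carries the value over to \<open>s\<close>.\<close>
    obtain r where r: "s < of_rat r" "of_rat r < min t (s + e)"
      using of_rat_dense[of s "min t (s + e)"] s e by auto
    show "ctmc_X Y T s \<omega> = x"
      using e(2)[of "of_rat r"] k[of r] r s by auto
  qed auto
qed

section \<open>Jump times and measurability of the hitting time\<close>

definition jumps_into :: "(nat \<Rightarrow> 'a \<Rightarrow> 'b::t2_space) \<Rightarrow> (nat \<Rightarrow> 'a \<Rightarrow> real) \<Rightarrow> 'b set \<Rightarrow> real \<Rightarrow> 'a \<Rightarrow> bool" where
  "jumps_into Y T A t \<omega> \<longleftrightarrow> 0 < t \<and> Lim (at_left t) (\<lambda>s. ctmc_X Y T s \<omega>) \<noteq> ctmc_X Y T t \<omega> \<and> ctmc_X Y T t \<omega> \<in> A"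

lemma hit_time_eq: "hit_time Y T A \<omega> = Inf (ereal ` {t. jumps_into Y T A t \<omega>})"
  unfolding hit_time_def jumps_into_def ..

text \<open>\<open>Lim\<close> is total: where no left limit exists it returns the description of an
  empty predicate, and \<open>hit_time\<close> compares the state with this default. The second
  disjunct accounts for it.\<close>

lemma Lim_at_left_ctmc_X_eq_iff:
  fixes Y :: "nat \<Rightarrow> 'a \<Rightarrow> 'b :: t2_space"
  assumes discrete: "\<And>x :: 'b. open {x}"
  shows "Lim (at_left t) (\<lambda>s. ctmc_X Y T s \<omega>) = x \<longleftrightarrow>
    left_const Y T t \<omega> x \<or> (\<forall>y. \<not> left_const Y T t \<omega> y) \<and> x = (THE x. False)"
proof (cases "\<exists>y. left_const Y T t \<omega> y")
  case True
  then obtain y where y: "left_const Y T t \<omega> y" by blast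
  hence "((\<lambda>s. ctmc_X Y T s \<omega>) \<longlongrightarrow> y) (at_left t)"
    by (simp add: tendsto_at_left_iff_left_const[OF discrete])
  hence "Lim (at_left t) (\<lambda>s. ctmc_X Y T s \<omega>) = y" by (intro tendsto_Lim) auto
  moreover have "left_const Y T t \<omega> x \<longleftrightarrow> x = y"
    using y \<open>((\<lambda>s. ctmc_X Y T s \<omega>) \<longlongrightarrow> y) (at_left t)\<close> tendsto_unique[of "at_left t"]
    by (auto simp flip: tendsto_at_left_iff_left_const[OF discrete])
  ultimately show ?thesis using True by auto
next
  case False
  thus ?thesis unfolding t2_space_class.Lim_def tendsto_at_left_iff_left_const[OF discrete] by auto
qed

lemma not_jumps_into_if_left_constant:
  assumes "b < t" "\<And>s. b < s \<Longrightarrow> s < t \<Longrightarrow> ctmc_X Y T s \<omega> = ctmc_X Y T t \<omega>"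
  shows "\<not> jumps_into Y T A t \<omega>"
proof -
  have "((\<lambda>s. ctmc_X Y T s \<omega>) \<longlongrightarrow> ctmc_X Y T t \<omega>) (at_left t)"
    using assms by (intro tendsto_eventually) (auto simp: eventually_at_left_field)
  hence "Lim (at_left t) (\<lambda>s. ctmc_X Y T s \<omega>) = ctmc_X Y T t \<omega>" by (intro tendsto_Lim) auto
  thus ?thesis by (simp add: jumps_into_def)
qed

text \<open>Away from the partial sums and their supremum the path is constant on an interval to the
  left of \<open>t\<close>, in the exploded regime as well. This reduces an uncountable infimum to
  countably many candidates.\<close>

lemma jumps_into_times:
  assumes "jumps_into Y T A t \<omega>"
  shows "(\<exists>n. t = (\<Sum>k\<le>n. T k \<omega>)) \<or> t = real_of_ereal (SUP n. ereal (\<Sum>k\<le>n. T k \<omega>))"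
proof (rule ccontr)
  assume "\<not> ?thesis"
  hence neq: "\<And>n. t \<noteq> (\<Sum>k\<le>n. T k \<omega>)" and neq': "t \<noteq> real_of_ereal (SUP n. ereal (\<Sum>k\<le>n. T k \<omega>))" by auto
  show False
  proof (cases rule: ctmc_X_cases[of t T \<omega>])
    case (alive n)
    \<comment> \<open>The entry \<open>t - 1\<close> keeps the set nonempty when
      \<open>n = 0\<close>.\<close>
    define b where "b = Max (insert (t - 1) ((\<lambda>m. \<Sum>k\<le>m. T k \<omega>) ` {..<n}))"
    have "b < t" unfolding b_def using alive(2) neq by (subst Max_less_iff) (auto simp: less_le)
    have "ctmc_X Y T s \<omega> = ctmc_X Y T t \<omega>" if s: "b < s" "s < t" for s
    proof -
      have "(\<Sum>k\<le>m. T k \<omega>) < s" if "m < n" for m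
        using s that unfolding b_def by (subst (asm) Max_less_iff) auto
      with s alive show ?thesis by (subst (1 2) ctmc_X_eqI[where n = n]) (auto intro: less_imp_le)
    qed
    with not_jumps_into_if_left_constant[OF \<open>b < t\<close>, of Y T \<omega> A] assms show False by blast
  next
    case exploded
    define u where "u = (SUP n. ereal (\<Sum>k\<le>n. T k \<omega>))"
    have "u \<le> ereal t" unfolding u_def using exploded by (intro SUP_least) auto
    moreover have u: "ereal (\<Sum>k\<le>n. T k \<omega>) \<le> u" for n unfolding u_def by (intro SUP_upper) auto
    ultimately obtain b where b: "u = ereal b" using u[of 0] by (cases u) auto
    hence "b < t" using \<open>u \<le> ereal t\<close> neq' by (auto simp: u_def[symmetric])
    have "ctmc_X Y T s \<omega> = ctmc_X Y T t \<omega>" if s: "b < s" "s < t" for s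
    proof -
      have "(\<Sum>k\<le>n. T k \<omega>) \<le> s" for n using u[of n] b s by auto
      thus ?thesis using exploded by (simp add: ctmc_X_explosion)
    qed
    with not_jumps_into_if_left_constant[OF \<open>b < t\<close>, of Y T \<omega> A] assms show False by blast
  qed
qed

text \<open>Time and sample point both vary measurably over \<open>N\<close>. This covers a fixed
  path, random times and the product space on which Fubini is applied.\<close>

lemma measurable_ctmc_X [measurable]:
  fixes Y :: "nat \<Rightarrow> 'a \<Rightarrow> 'b"
  assumes [measurable]: "\<And>n. Y n \<in> measurable M (count_space UNIV)" "\<And>n. T n \<in> borel_measurable M"
    and [measurable]: "f \<in> borel_measurable N" "g \<in> measurable N M"
  shows "(\<lambda>x. ctmc_X Y T (f x) (g x)) \<in> measurable N (count_space UNIV)"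
  unfolding ctmc_X_def by (rule measurable_compose_countable) measurable

lemma pred_left_const [measurable]:
  fixes Y :: "nat \<Rightarrow> 'a \<Rightarrow> 'b"
  assumes [measurable]: "\<And>n. Y n \<in> measurable M (count_space UNIV)" "\<And>n. T n \<in> borel_measurable M"
    and [measurable]: "f \<in> borel_measurable M"
  shows "Measurable.pred M (\<lambda>\<omega>. left_const Y T (f \<omega>) \<omega> x)"
  unfolding left_const_def by measurable

lemma pred_jumps_into [measurable]:
  fixes Y :: "nat \<Rightarrow> 'a \<Rightarrow> 'b :: {countable, t2_space}"
  assumes discrete: "\<And>x :: 'b. open {x}"
    and [measurable]: "\<And>n. Y n \<in> measurable M (count_space UNIV)" "\<And>n. T n \<in> borel_measurable M"
    and [measurable]: "f \<in> borel_measurable M"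
  shows "Measurable.pred M (\<lambda>\<omega>. jumps_into Y T A (f \<omega>) \<omega>)"
proof -
  have "jumps_into Y T A (f \<omega>) \<omega> \<longleftrightarrow> 0 < f \<omega> \<and> (\<exists>x. ctmc_X Y T (f \<omega>) \<omega> = x \<and> x \<in> A \<and>
      \<not> (left_const Y T (f \<omega>) \<omega> x \<or> (\<forall>y. \<not> left_const Y T (f \<omega>) \<omega> y) \<and> x = (THE x. False)))" for \<omega>
    unfolding jumps_into_def Lim_at_left_ctmc_X_eq_iff[OF discrete] by auto
  thus ?thesis by simp
qed

text \<open>The Bochner integral of a non-measurable function is \<open>0\<close> and the underlying measure need not be
  complete, so measurability is needed on all paths, including those with negative holding times or explosion.
  It holds because every jump time is a partial sum of holding times or the explosion time.\<close>

lemma measurable_hit_time: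
  fixes Y :: "nat \<Rightarrow> 'a \<Rightarrow> 'b :: {countable, t2_space}"
  assumes discrete: "\<And>x :: 'b. open {x}"
    and [measurable]: "\<And>n. Y n \<in> measurable M (count_space UNIV)" "\<And>n. T n \<in> borel_measurable M"
  shows "hit_time Y T A \<in> borel_measurable M"
proof -
  define s where "s n \<omega> = (\<Sum>k\<le>n. T k \<omega>)" for n \<omega>
  define u where "u \<omega> = real_of_ereal (SUP n. ereal (s n \<omega>))" for \<omega>
  have [measurable]: "s n \<in> borel_measurable M" for n unfolding s_def by measurable
  have [measurable]: "u \<in> borel_measurable M" unfolding u_def by measurable
  have [measurable]: "Measurable.pred M (\<lambda>\<omega>. jumps_into Y T A (s n \<omega>) \<omega>)" for n
    by (rule pred_jumps_into[OF discrete]) measurable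
  have [measurable]: "Measurable.pred M (\<lambda>\<omega>. jumps_into Y T A (u \<omega>) \<omega>)"
    by (rule pred_jumps_into[OF discrete]) measurable
  have "hit_time Y T A \<omega> = min (INF n. if jumps_into Y T A (s n \<omega>) \<omega> then ereal (s n \<omega>) else \<infinity>)
      (if jumps_into Y T A (u \<omega>) \<omega> then ereal (u \<omega>) else \<infinity>)" (is "_ = min ?i ?j") for \<omega>
  proof (rule antisym)
    show "hit_time Y T A \<omega> \<le> min ?i ?j"
    proof (rule min.boundedI)
      show "hit_time Y T A \<omega> \<le> ?i"
        unfolding hit_time_eq by (rule INF_greatest) (simp add: Inf_lower)
      show "hit_time Y T A \<omega> \<le> ?j"
        unfolding hit_time_eq by (simp add: Inf_lower)
    qed
    show "min ?i ?j \<le> hit_time Y T A \<omega>"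
      unfolding hit_time_eq
    proof (rule Inf_greatest, safe)
      fix t assume t: "jumps_into Y T A t \<omega>"
      then consider n where "t = s n \<omega>" | "t = u \<omega>"
        using jumps_into_times[OF t] by (auto simp: s_def u_def)
      thus "min ?i ?j \<le> ereal t"
      proof cases
        case 1
        thus ?thesis using t by (intro min.coboundedI1 INF_lower2[of n]) auto
      qed (use t in auto)
    qed
  qed
  hence "hit_time Y T A = (\<lambda>\<omega>. min (INF n. if jumps_into Y T A (s n \<omega>) \<omega> then ereal (s n \<omega>) else \<infinity>)
      (if jumps_into Y T A (u \<omega>) \<omega> then ereal (u \<omega>) else \<infinity>))" by blast
  moreover have "\<dots> \<in> borel_measurable M" by measurable
  ultimately show ?thesis by (simp only:)
qed

lemma hit_time_nonneg: "0 \<le> hit_time Y T A \<omega>"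
  unfolding hit_time_eq by (intro Inf_greatest) (auto simp: jumps_into_def)

section \<open>Markov jump chains and Dynkin's formula\<close>

lemma qout_eq_sum_support:
  assumes "q x x = 0" "finite {y. q x y \<noteq> 0}"
  shows "qout q x = (\<Sum>y | q x y \<noteq> 0. q x y)"
proof -
  have "qout q x = infsum (q x) {y. q x y \<noteq> 0}"
    unfolding qout_def by (rule infsum_cong_neutral) (auto simp: assms(1))
  thus ?thesis using assms(2) by simp
qed

text \<open>The bound \<open>C\<close> on the exit rates excludes explosion and keeps
  \<open>resolvent_op\<close> of a bounded function bounded. \<open>discrete\<close> turns the left
  limit inside \<open>hit_time\<close> into eventual constancy.\<close>

locale jump_chain = prob_space M for M :: "'a measure" +
  fixes q :: "'b :: {countable, t2_space} \<Rightarrow> 'b \<Rightarrow> real" and C :: real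
    and z :: 'b and Y :: "nat \<Rightarrow> 'a \<Rightarrow> 'b" and T :: "nat \<Rightarrow> 'a \<Rightarrow> real"
  assumes law: "jump_chain_law q M Y T z"
    and discrete: "\<And>x :: 'b. open {x}"
    and rate_nonneg: "\<And>x y. 0 \<le> q x y" and rate_diag: "\<And>x. q x x = 0"
    and finite_succs: "\<And>x. finite {y. q x y \<noteq> 0}"
    and qout_pos: "\<And>x. 0 < qout q x" and qout_le: "\<And>x. qout q x \<le> C"
begin

definition succs :: "'b \<Rightarrow> 'b set" where
  "succs x = {y. q x y \<noteq> 0}"

definition S :: "nat \<Rightarrow> 'a \<Rightarrow> real" where
  "S n \<omega> = (\<Sum>k<n. T k \<omega>)"

lemma finite_succs' [simp, intro]: "finite (succs x)"
  using finite_succs by (simp add: succs_def)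

lemma qout_eq_sum: "qout q x = (\<Sum>y\<in>succs x. q x y)"
  unfolding succs_def by (rule qout_eq_sum_support[OF rate_diag finite_succs])

lemma measurable_Y [measurable]: "Y n \<in> measurable M (count_space UNIV)"
  using law by (simp add: jump_chain_law_def)

lemma measurable_T [measurable]: "T n \<in> borel_measurable M"
  using law by (simp add: jump_chain_law_def)

lemma measurable_S [measurable]: "S n \<in> borel_measurable M"
  unfolding S_def by measurable

lemma S_0 [simp]: "S 0 \<omega> = 0" and S_Suc: "S (Suc n) \<omega> = S n \<omega> + T n \<omega>"
  by (simp_all add: S_def)

lemma prob_path:
  assumes "\<And>k. k < n \<Longrightarrow> 0 \<le> s k"
  shows "prob {\<omega> \<in> space M. (\<forall>k\<le>n. Y k \<omega> = ys k) \<and> (\<forall>k<n. s k < T k \<omega>)} =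
    (if ys 0 = z then
       (\<Prod>k<n. q (ys k) (ys (Suc k)) / qout q (ys k) * exp (- qout q (ys k) * s k)) else 0)"
  using law assms by (simp add: jump_chain_law_def)

text \<open>The one-step extensions of a cylinder to successors, with positive holding times, have
  total mass equal to that of the cylinder because the normalised rates sum to 1; what remains is
  null. Positivity of the earlier holding times is a premise since the prefix law speaks of them
  jointly; induction removes it in \<open>AE_path\<close>.\<close>

lemma AE_step:
  "AE \<omega> in M. (\<forall>k<n. 0 < T k \<omega>) \<longrightarrow> Y (Suc n) \<omega> \<in> succs (Y n \<omega>) \<and> 0 < T n \<omega>"
proof -
  have *: "AE \<omega> in M. (\<forall>k\<le>n. Y k \<omega> = ys k) \<longrightarrow> (\<forall>k<n. 0 < T k \<omega>) \<longrightarrow>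
      Y (Suc n) \<omega> \<in> succs (Y n \<omega>) \<and> 0 < T n \<omega>" for ys :: "nat \<Rightarrow> 'b"
  proof -
    define E where "E = {\<omega> \<in> space M. (\<forall>k\<le>n. Y k \<omega> = ys k) \<and> (\<forall>k<n. 0 < T k \<omega>)}"
    define E' where "E' y = {\<omega> \<in> space M. (\<forall>k\<le>Suc n. Y k \<omega> = (ys(Suc n := y)) k) \<and> (\<forall>k<Suc n. 0 < T k \<omega>)}" for y
    define p where "p = (if ys 0 = z then (\<Prod>k<n. q (ys k) (ys (Suc k)) / qout q (ys k)) else 0)"
    have [measurable]: "E \<in> sets M" "E' y \<in> sets M" for y
      unfolding E_def E'_def by measurable
    have E: "prob E = p"
      unfolding E_def p_def using prob_path[of n "\<lambda>_. 0" ys] by simp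
    have E': "prob (E' y) = p * (q (ys n) y / qout q (ys n))" for y
      unfolding E'_def p_def using prob_path[of "Suc n" "\<lambda>_. 0" "ys(Suc n := y)"] by simp
    have disj: "disjoint_family_on E' (succs (ys n))"
      unfolding disjoint_family_on_def E'_def by auto
    have sub: "(\<Union>y\<in>succs (ys n). E' y) \<subseteq> E"
      unfolding E_def E'_def by (auto simp: fun_upd_def split: if_splits)
    have "prob (\<Union>y\<in>succs (ys n). E' y) = (\<Sum>y\<in>succs (ys n). prob (E' y))"
      by (rule finite_measure_finite_Union) (use disj in auto)
    also have "\<dots> = p * ((\<Sum>y\<in>succs (ys n). q (ys n) y) / qout q (ys n))"
      by (simp only: E' flip: sum_distrib_left sum_divide_distrib)
    also have "\<dots> = p"
      using qout_pos[of "ys n"] by (simp flip: qout_eq_sum)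
    finally have "prob (E - (\<Union>y\<in>succs (ys n). E' y)) = 0"
      using sub E by (subst finite_measure_Diff) auto
    hence "AE \<omega> in M. \<omega> \<notin> E - (\<Union>y\<in>succs (ys n). E' y)"
      by (subst (asm) prob_eq_0) auto
    moreover have "AE \<omega> in M. \<omega> \<in> space M" by (rule AE_space)
    ultimately show ?thesis
    proof eventually_elim
      case (elim \<omega>)
      show ?case
      proof (intro impI)
        assume "\<forall>k\<le>n. Y k \<omega> = ys k" "\<forall>k<n. 0 < T k \<omega>"
        with elim obtain y where y: "y \<in> succs (ys n)" "\<omega> \<in> E' y"
          by (auto simp: E_def)
        thus "Y (Suc n) \<omega> \<in> succs (Y n \<omega>) \<and> 0 < T n \<omega>"
          using \<open>\<forall>k\<le>n. Y k \<omega> = ys k\<close> by (auto simp: E'_def)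
      qed
    qed
  qed
  have cnt: "countable (PiE {..n} (\<lambda>_. UNIV :: 'b set))"
    by (rule countable_PiE) auto
  have "AE \<omega> in M. \<forall>ys\<in>PiE {..n} (\<lambda>_. UNIV :: 'b set). (\<forall>k\<le>n. Y k \<omega> = ys k) \<longrightarrow> (\<forall>k<n. 0 < T k \<omega>) \<longrightarrow>
      Y (Suc n) \<omega> \<in> succs (Y n \<omega>) \<and> 0 < T n \<omega>"
    using * by (subst AE_ball_countable[OF cnt]) auto
  thus ?thesis
  proof eventually_elim
    case (elim \<omega>)
    have "restrict (\<lambda>k. Y k \<omega>) {..n} \<in> PiE {..n} (\<lambda>_. UNIV)" by auto
    from elim[rule_format, OF this] show ?case by auto
  qed
qed

lemma AE_start: "AE \<omega> in M. Y 0 \<omega> = z"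
proof -
  have "prob {\<omega> \<in> space M. Y 0 \<omega> = z} = 1"
    using prob_path[of 0 "\<lambda>_. 0" "\<lambda>_. z"] by simp
  thus ?thesis by (subst (asm) prob_Collect_eq_1) auto
qed

lemma AE_path: "AE \<omega> in M. Y 0 \<omega> = z \<and> (\<forall>n. Y (Suc n) \<omega> \<in> succs (Y n \<omega>)) \<and> (\<forall>n. 0 < T n \<omega>)"
proof -
  have "AE \<omega> in M. \<forall>n. (\<forall>k<n. 0 < T k \<omega>) \<longrightarrow> Y (Suc n) \<omega> \<in> succs (Y n \<omega>) \<and> 0 < T n \<omega>"
    using AE_step by (subst AE_all_countable) auto
  with AE_start show ?thesis
  proof eventually_elim
    case (elim \<omega>)
    have "0 < T n \<omega>" for n
      by (induction n rule: less_induct) (use elim in auto)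
    with elim show ?case by auto
  qed
qed

lemma AE_S_nonneg: "AE \<omega> in M. \<forall>n. 0 \<le> S n \<omega>"
  using AE_path by eventually_elim (simp add: S_def sum_nonneg less_imp_le)

section \<open>Transforms of jump times along finite histories\<close>

definition cyl :: "nat \<Rightarrow> (nat \<Rightarrow> 'b) \<Rightarrow> 'a set" where
  "cyl n ys = {\<omega> \<in> space M. \<forall>k\<le>n. Y k \<omega> = ys k}"

lemma sets_cyl [measurable]: "cyl n ys \<in> sets M"
  unfolding cyl_def by measurable

text \<open>The prescribed law knows holding times through tail events. The induction converts them
  one at a time: the first \<open>j\<close> already sit in the transform, the others are still tail
  events. Converting \<open>T j\<close> multiplies by \<open>r / (a + r)\<close> with
  \<open>r\<close> its exit rate, so \<open>q / r\<close> becomes \<open>q / (a + r)\<close>. The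
  tail required for this is the induction hypothesis with threshold \<open>r\<close> at position
  \<open>j\<close>.\<close>

lemma expectation_exp_cyl_aux:
  assumes "0 < Re a" "j \<le> n" "\<And>k. k < n \<Longrightarrow> 0 \<le> s k"
  shows "expectation (\<lambda>\<omega>. exp (- a * of_real (S j \<omega>)) *
      indicator {\<omega> \<in> space M. (\<forall>k\<le>n. Y k \<omega> = ys k) \<and> (\<forall>k\<in>{j..<n}. s k < T k \<omega>)} \<omega>) =
    (if ys 0 = z then (\<Prod>k<j. of_real (q (ys k) (ys (Suc k))) / (a + of_real (qout q (ys k)))) *
       of_real (\<Prod>k=j..<n. q (ys k) (ys (Suc k)) / qout q (ys k) * exp (- qout q (ys k) * s k)) else 0)"
  using assms(2,3)
proof (induction j arbitrary: s)
  case 0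
  define E where "E = {\<omega> \<in> space M. (\<forall>k\<le>n. Y k \<omega> = ys k) \<and> (\<forall>k\<in>{0..<n}. s k < T k \<omega>)}"
  have [measurable]: "E \<in> sets M" unfolding E_def by measurable
  have "E = {\<omega> \<in> space M. (\<forall>k\<le>n. Y k \<omega> = ys k) \<and> (\<forall>k<n. s k < T k \<omega>)}"
    by (auto simp: E_def)
  moreover have "expectation (\<lambda>\<omega>. indicator E \<omega> :: complex) = expectation (\<lambda>\<omega>. of_real (indicator E \<omega>))"
    by (rule Bochner_Integration.integral_cong) (auto simp: indicator_def)
  ultimately have "expectation (\<lambda>\<omega>. indicator E \<omega>) =
    complex_of_real (prob {\<omega> \<in> space M. (\<forall>k\<le>n. Y k \<omega> = ys k) \<and> (\<forall>k<n. s k < T k \<omega>)})"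
    by simp
  thus ?case
    using prob_path[of n s ys] 0 by (simp add: atLeast0LessThan E_def)
next
  case (Suc j)
  define E where "E = {\<omega> \<in> space M. (\<forall>k\<le>n. Y k \<omega> = ys k) \<and> (\<forall>k\<in>{Suc j..<n}. s k < T k \<omega>)}"
  have [measurable]: "E \<in> sets M" unfolding E_def by measurable
  define c where "c = (if ys 0 = z then (\<Prod>k<j. of_real (q (ys k) (ys (Suc k))) / (a + of_real (qout q (ys k)))) *
       of_real (q (ys j) (ys (Suc j)) / qout q (ys j)) *
       of_real (\<Prod>k=Suc j..<n. q (ys k) (ys (Suc k)) / qout q (ys k) * exp (- qout q (ys k) * s k)) else 0)"
  have "expectation (\<lambda>\<omega>. exp (- a * of_real (S j \<omega>)) * indicator E \<omega> * exp (- a * of_real (T j \<omega>))) =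
      c * (of_real (qout q (ys j)) / (a + of_real (qout q (ys j))))"
  proof (rule expectation_mult_exp_of_exponential_tail[where B = 1])
    show "AE \<omega> in M. cmod (exp (- a * of_real (S j \<omega>)) * indicator E \<omega>) \<le> 1"
      using AE_S_nonneg by eventually_elim (use assms(1) in \<open>auto simp: indicator_def norm_exp_eq_Re\<close>)
    show "AE \<omega> in M. 0 < T j \<omega>" using AE_path by eventually_elim auto
  next
    fix r :: real assume "0 \<le> r"
    have exp_eq: "exp (- complex_of_real (qout q (ys j) * r)) = of_real (exp (- qout q (ys j) * r))"
      by (simp flip: exp_of_real)
    have "expectation (\<lambda>\<omega>. exp (- a * of_real (S j \<omega>)) * indicator E \<omega> * indicator {\<omega>. r < T j \<omega>} \<omega>) =
      expectation (\<lambda>\<omega>. exp (- a * of_real (S j \<omega>)) *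
      indicator {\<omega> \<in> space M. (\<forall>k\<le>n. Y k \<omega> = ys k) \<and> (\<forall>k\<in>{j..<n}. (s(j := r)) k < T k \<omega>)} \<omega>)"
    proof (rule Bochner_Integration.integral_cong)
      fix \<omega> assume "\<omega> \<in> space M"
      have "{j..<n} = insert j {Suc j..<n}" using Suc.prems by auto
      hence "(\<forall>k\<in>{j..<n}. (s(j := r)) k < T k \<omega>) \<longleftrightarrow> r < T j \<omega> \<and> (\<forall>k\<in>{Suc j..<n}. s k < T k \<omega>)"
        by auto
      thus "exp (- a * of_real (S j \<omega>)) * indicator E \<omega> * indicator {\<omega>. r < T j \<omega>} \<omega> =
         exp (- a * of_real (S j \<omega>)) *
      indicator {\<omega> \<in> space M. (\<forall>k\<le>n. Y k \<omega> = ys k) \<and> (\<forall>k\<in>{j..<n}. (s(j := r)) k < T k \<omega>)} \<omega>"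
        by (auto simp: indicator_def E_def)
    qed simp
    also have "\<dots> = (if ys 0 = z then (\<Prod>k<j. of_real (q (ys k) (ys (Suc k))) / (a + of_real (qout q (ys k)))) *
       of_real (\<Prod>k=j..<n. q (ys k) (ys (Suc k)) / qout q (ys k) * exp (- qout q (ys k) * (s(j := r)) k)) else 0)"
      using Suc.prems \<open>0 \<le> r\<close> by (intro Suc.IH) auto
    also have "(\<Prod>k=j..<n. q (ys k) (ys (Suc k)) / qout q (ys k) * exp (- qout q (ys k) * (s(j := r)) k)) =
      q (ys j) (ys (Suc j)) / qout q (ys j) * exp (- qout q (ys j) * r) *
      (\<Prod>k=Suc j..<n. q (ys k) (ys (Suc k)) / qout q (ys k) * exp (- qout q (ys k) * s k))"
      using Suc.prems by (subst prod.atLeast_Suc_lessThan) (auto intro!: prod.cong)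
    finally show "expectation (\<lambda>\<omega>. exp (- a * of_real (S j \<omega>)) * indicator E \<omega> * indicator {\<omega>. r < T j \<omega>} \<omega>)
      = c * exp (- of_real (qout q (ys j) * r))"
      unfolding exp_eq c_def by simp
  qed (use assms qout_pos[of "ys j"] in \<open>auto intro: less_imp_le\<close>)
  also have "(\<lambda>\<omega>. exp (- a * of_real (S j \<omega>)) * indicator E \<omega> * exp (- a * of_real (T j \<omega>))) =
      (\<lambda>\<omega>. exp (- a * of_real (S (Suc j) \<omega>)) * indicator E \<omega>)"
    by (auto simp: S_Suc algebra_simps exp_add exp_diff exp_minus divide_simps)
  also have "c * (of_real (qout q (ys j)) / (a + of_real (qout q (ys j)))) =
    (if ys 0 = z then (\<Prod>k<Suc j. of_real (q (ys k) (ys (Suc k))) / (a + of_real (qout q (ys k)))) *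
       of_real (\<Prod>k=Suc j..<n. q (ys k) (ys (Suc k)) / qout q (ys k) * exp (- qout q (ys k) * s k)) else 0)"
    using qout_pos[of "ys j"] by (simp add: c_def)
  finally show ?case unfolding E_def .
qed

lemma expectation_exp_cyl:
  assumes "0 < Re a"
  shows "expectation (\<lambda>\<omega>. exp (- a * of_real (S n \<omega>)) * indicator (cyl n ys) \<omega>) =
    (if ys 0 = z then (\<Prod>k<n. of_real (q (ys k) (ys (Suc k))) / (a + of_real (qout q (ys k)))) else 0)"
  using expectation_exp_cyl_aux[of a n n "\<lambda>_. 0" ys] assms by (simp add: cyl_def)

text \<open>This is \<open>a - Q\<close> for the generator \<open>Q\<close>, whose diagonal entries
  are \<open>- qout q x\<close>.\<close>

definition resolvent_op :: "complex \<Rightarrow> ('b \<Rightarrow> complex) \<Rightarrow> 'b \<Rightarrow> complex" where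
  "resolvent_op a f x = (a + of_real (qout q x)) * f x - (\<Sum>y\<in>succs x. of_real (q x y) * f y)"

definition alive :: "'b set \<Rightarrow> nat \<Rightarrow> 'a set" where
  "alive D n = {\<omega> \<in> space M. \<forall>k\<le>n. Y k \<omega> \<in> D}"

lemma sets_alive [measurable]: "alive D n \<in> sets M"
  unfolding alive_def by measurable

primrec reach :: "nat \<Rightarrow> 'b set" where
  "reach 0 = {z}"
| "reach (Suc n) = (\<Union>x\<in>reach n. succs x)"

lemma finite_reach [simp, intro]: "finite (reach n)"
  by (induction n) auto

text \<open>Finite branching leaves, up to a null set, finitely many histories of each length.
  Expectations over paths are then finite sums over cylinders.\<close>

definition hist :: "nat \<Rightarrow> (nat \<Rightarrow> 'b) set" where
  "hist n = PiE {..n} reach"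

lemma finite_hist [simp, intro]: "finite (hist n)"
  unfolding hist_def by (intro finite_PiE) auto

lemma AE_reach: "AE \<omega> in M. \<forall>n. Y n \<omega> \<in> reach n"
  using AE_path
proof eventually_elim
  case (elim \<omega>)
  have "Y n \<omega> \<in> reach n" for n
    by (induction n) (use elim in auto)
  thus ?case by blast
qed

lemma sum_hist_indicator:
  fixes h :: "(nat \<Rightarrow> 'b) \<Rightarrow> complex"
  assumes "\<omega> \<in> space M" "\<forall>n. Y n \<omega> \<in> reach n"
  shows "(\<Sum>ys\<in>hist n. h ys * indicator (cyl n ys) \<omega>) = h (restrict (\<lambda>k. Y k \<omega>) {..n})"
proof -
  have *: "indicator (cyl n ys) \<omega> = (if ys = restrict (\<lambda>k. Y k \<omega>) {..n} then 1 else (0 :: complex))"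
    if "ys \<in> hist n" for ys
    using that assms(1) by (auto simp: cyl_def indicator_def hist_def PiE_def extensional_def fun_eq_iff)
  have "(\<Sum>ys\<in>hist n. h ys * indicator (cyl n ys) \<omega>) =
      (\<Sum>ys\<in>hist n. if ys = restrict (\<lambda>k. Y k \<omega>) {..n} then h ys else 0)"
    by (rule sum.cong) (auto simp: *)
  also have "\<dots> = h (restrict (\<lambda>k. Y k \<omega>) {..n})"
    using assms by (subst sum.delta[OF finite_hist]) (auto simp: hist_def)
  finally show ?thesis .
qed

lemma integrable_exp_cyl:
  assumes "0 < Re a"
  shows "integrable M (\<lambda>\<omega>. exp (- a * of_real (S n \<omega>)) * indicator (cyl m ys) \<omega>)"
proof (rule integrable_const_bound[where B = 1])
  show "AE \<omega> in M. cmod (exp (- a * of_real (S n \<omega>)) * indicator (cyl m ys) \<omega>) \<le> 1"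
    using AE_S_nonneg by eventually_elim (use assms in \<open>auto simp: indicator_def norm_exp_eq_Re\<close>)
qed measurable

text \<open>The Markov property for one transition, with the last holding time integrated out. Both
  sides expand over cylinders: \<open>c ys\<close> records survival in \<open>D\<close>,
  \<open>p ys\<close> the transform on the history, and one more step contributes
  \<open>q / (a + qout)\<close>.\<close>

lemma markov_step:
  assumes "0 < Re a"
  shows "expectation (\<lambda>\<omega>. exp (- a * of_real (S (Suc n) \<omega>)) * (indicator (alive D n) \<omega> * f (Y n \<omega>) (Y (Suc n) \<omega>))) =
    expectation (\<lambda>\<omega>. exp (- a * of_real (S n \<omega>)) * (indicator (alive D n) \<omega> *
      ((\<Sum>y\<in>succs (Y n \<omega>). of_real (q (Y n \<omega>) y) * f (Y n \<omega>) y) / (a + of_real (qout q (Y n \<omega>))))))"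
proof -
  define c :: "(nat \<Rightarrow> 'b) \<Rightarrow> complex" where "c ys = (if \<forall>k\<le>n. ys k \<in> D then 1 else 0)" for ys
  define p where "p ys = (if ys 0 = z then (\<Prod>k<n. of_real (q (ys k) (ys (Suc k))) / (a + of_real (qout q (ys k)))) else 0)" for ys
  define u where "u x = (\<Sum>y\<in>succs x. of_real (q x y) * f x y) / (a + of_real (qout q x))" for x
  have "expectation (\<lambda>\<omega>. exp (- a * of_real (S (Suc n) \<omega>)) * (indicator (alive D n) \<omega> * f (Y n \<omega>) (Y (Suc n) \<omega>))) =
    expectation (\<lambda>\<omega>. \<Sum>ys\<in>hist n. \<Sum>y\<in>succs (ys n). (c ys * f (ys n) y) *
      (exp (- a * of_real (S (Suc n) \<omega>)) * indicator (cyl (Suc n) (ys(Suc n := y))) \<omega>))"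
  proof (rule integral_cong_AE)
    show "AE \<omega> in M. exp (- a * of_real (S (Suc n) \<omega>)) * (indicator (alive D n) \<omega> * f (Y n \<omega>) (Y (Suc n) \<omega>)) =
      (\<Sum>ys\<in>hist n. \<Sum>y\<in>succs (ys n). (c ys * f (ys n) y) *
      (exp (- a * of_real (S (Suc n) \<omega>)) * indicator (cyl (Suc n) (ys(Suc n := y))) \<omega>))"
      using AE_path AE_reach AE_space
    proof eventually_elim
      case (elim \<omega>)
      have ind: "indicator (cyl (Suc n) (ys(Suc n := y))) \<omega> =
          (if y = Y (Suc n) \<omega> then indicator (cyl n ys) \<omega> else (0 :: complex))" for ys y
        using elim by (auto simp: cyl_def indicator_def le_Suc_eq)
      have "(\<Sum>ys\<in>hist n. \<Sum>y\<in>succs (ys n). (c ys * f (ys n) y) *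
          (exp (- a * of_real (S (Suc n) \<omega>)) * indicator (cyl (Suc n) (ys(Suc n := y))) \<omega>)) =
        (\<Sum>ys\<in>hist n. exp (- a * of_real (S (Suc n) \<omega>)) * c ys *
           (\<Sum>y\<in>succs (ys n). if y = Y (Suc n) \<omega> then f (ys n) y else 0) * indicator (cyl n ys) \<omega>)"
        unfolding sum_distrib_left sum_distrib_right ind by (intro sum.cong) auto
      also have "\<dots> = exp (- a * of_real (S (Suc n) \<omega>)) * indicator (alive D n) \<omega> *
           (\<Sum>y\<in>succs (Y n \<omega>). if y = Y (Suc n) \<omega> then f (Y n \<omega>) y else 0)"
        using elim by (subst sum_hist_indicator) (auto simp: c_def alive_def)
      also have "\<dots> = exp (- a * of_real (S (Suc n) \<omega>)) * (indicator (alive D n) \<omega> * f (Y n \<omega>) (Y (Suc n) \<omega>))"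
        using elim by (subst sum.delta) auto
      finally show ?case ..
    qed
  qed measurable
  also have "\<dots> = (\<Sum>ys\<in>hist n. \<Sum>y\<in>succs (ys n). (c ys * f (ys n) y) *
     expectation (\<lambda>\<omega>. exp (- a * of_real (S (Suc n) \<omega>)) * indicator (cyl (Suc n) (ys(Suc n := y))) \<omega>))"
    by (subst Bochner_Integration.integral_sum | intro Bochner_Integration.integrable_sum
          integrable_mult_right integrable_exp_cyl assms sum.cong refl integral_mult_right_zero)+
  also have "\<dots> = (\<Sum>ys\<in>hist n. c ys * u (ys n) * p ys)"
  proof (rule sum.cong)
    fix ys assume "ys \<in> hist n"
    have "(\<Sum>y\<in>succs (ys n). (c ys * f (ys n) y) *
       expectation (\<lambda>\<omega>. exp (- a * of_real (S (Suc n) \<omega>)) * indicator (cyl (Suc n) (ys(Suc n := y))) \<omega>))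
      = (\<Sum>y\<in>succs (ys n). (c ys * f (ys n) y) * (p ys * (of_real (q (ys n) y) / (a + of_real (qout q (ys n))))))"
      by (subst expectation_exp_cyl[OF assms]) (auto simp: p_def)
    also have "\<dots> = c ys * u (ys n) * p ys"
      by (simp add: u_def sum_distrib_left sum_distrib_right sum_divide_distrib mult_ac)
    finally show "(\<Sum>y\<in>succs (ys n). (c ys * f (ys n) y) *
       expectation (\<lambda>\<omega>. exp (- a * of_real (S (Suc n) \<omega>)) * indicator (cyl (Suc n) (ys(Suc n := y))) \<omega>))
       = c ys * u (ys n) * p ys" .
  qed simp
  also have "\<dots> = (\<Sum>ys\<in>hist n. c ys * u (ys n) *
     expectation (\<lambda>\<omega>. exp (- a * of_real (S n \<omega>)) * indicator (cyl n ys) \<omega>))"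
    unfolding p_def by (subst expectation_exp_cyl[OF assms]) auto
  also have "\<dots> = expectation (\<lambda>\<omega>. \<Sum>ys\<in>hist n. c ys * u (ys n) * (exp (- a * of_real (S n \<omega>)) * indicator (cyl n ys) \<omega>))"
    by (subst Bochner_Integration.integral_sum | intro Bochner_Integration.integrable_sum
          integrable_mult_right integrable_exp_cyl assms sum.cong refl integral_mult_right_zero[symmetric])+
  also have "\<dots> = expectation (\<lambda>\<omega>. exp (- a * of_real (S n \<omega>)) * (indicator (alive D n) \<omega> * u (Y n \<omega>)))"
  proof (rule integral_cong_AE)
    show "AE \<omega> in M. (\<Sum>ys\<in>hist n. c ys * u (ys n) * (exp (- a * of_real (S n \<omega>)) * indicator (cyl n ys) \<omega>)) =
      exp (- a * of_real (S n \<omega>)) * (indicator (alive D n) \<omega> * u (Y n \<omega>))"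
      using AE_reach AE_space
    proof eventually_elim
      case (elim \<omega>)
      have "(\<Sum>ys\<in>hist n. c ys * u (ys n) * (exp (- a * of_real (S n \<omega>)) * indicator (cyl n ys) \<omega>)) =
         (\<Sum>ys\<in>hist n. (c ys * u (ys n) * exp (- a * of_real (S n \<omega>))) * indicator (cyl n ys) \<omega>)"
        by (simp add: mult_ac)
      also have "\<dots> = exp (- a * of_real (S n \<omega>)) * (indicator (alive D n) \<omega> * u (Y n \<omega>))"
        using elim by (subst sum_hist_indicator) (auto simp: c_def alive_def)
      finally show ?case .
    qed
  qed measurable
  finally show ?thesis unfolding u_def .
qed

section \<open>Geometric decay and absence of explosion\<close>

lemma C_pos: "0 < C"
  using qout_pos[of z] qout_le[of z] by linarith

lemma integrable_exp_S:
  assumes "0 < r"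
  shows "integrable M (\<lambda>\<omega>. exp (- r * S n \<omega>))"
proof (rule integrable_const_bound[where B = 1])
  show "AE \<omega> in M. norm (exp (- r * S n \<omega>)) \<le> 1"
    using AE_S_nonneg by eventually_elim (use assms in auto)
qed measurable

text \<open>By \<open>markov_step\<close> each holding time contributes \<open>x / (r + x)\<close>
  with \<open>x\<close> its exit rate; this increases in \<open>x\<close>, so it is at most
  \<open>C / (r + C)\<close>.\<close>

lemma expectation_exp_S_le:
  assumes "0 < r"
  shows "expectation (\<lambda>\<omega>. exp (- r * S n \<omega>)) \<le> (C / (r + C)) ^ n"
proof (induction n)
  case (Suc n)
  have "complex_of_real (expectation (\<lambda>\<omega>. exp (- r * S (Suc n) \<omega>))) =
    expectation (\<lambda>\<omega>. exp (- of_real r * of_real (S (Suc n) \<omega>)) * (indicator (alive UNIV n) \<omega> * 1))"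
    unfolding integral_complex_of_real[symmetric]
    by (rule Bochner_Integration.integral_cong) (auto simp: alive_def simp flip: exp_of_real)
  also have "\<dots> = expectation (\<lambda>\<omega>. exp (- of_real r * of_real (S n \<omega>)) * (indicator (alive UNIV n) \<omega> *
      ((\<Sum>y\<in>succs (Y n \<omega>). of_real (q (Y n \<omega>) y) * 1) / (of_real r + of_real (qout q (Y n \<omega>))))))"
    using assms by (intro markov_step) auto
  also have "\<dots> = complex_of_real (expectation (\<lambda>\<omega>. exp (- r * S n \<omega>) * (qout q (Y n \<omega>) / (r + qout q (Y n \<omega>)))))"
    unfolding integral_complex_of_real[symmetric]
    by (rule Bochner_Integration.integral_cong) (auto simp: alive_def qout_eq_sum simp flip: exp_of_real)
  finally have "expectation (\<lambda>\<omega>. exp (- r * S (Suc n) \<omega>)) =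
     expectation (\<lambda>\<omega>. exp (- r * S n \<omega>) * (qout q (Y n \<omega>) / (r + qout q (Y n \<omega>))))"
    using of_real_eq_iff by blast
  also have "\<dots> \<le> expectation (\<lambda>\<omega>. exp (- r * S n \<omega>) * (C / (r + C)))"
  proof (rule integral_mono')
    show "integrable M (\<lambda>\<omega>. exp (- r * S n \<omega>) * (C / (r + C)))"
      by (rule integrable_mult_left[OF integrable_exp_S[OF assms]])
    fix \<omega>
    show "exp (- r * S n \<omega>) * (qout q (Y n \<omega>) / (r + qout q (Y n \<omega>))) \<le> exp (- r * S n \<omega>) * (C / (r + C))"
      using qout_le[of "Y n \<omega>"] qout_pos[of "Y n \<omega>"] assms C_pos
      by (intro mult_left_mono) (auto simp: divide_simps algebra_simps)
    show "0 \<le> exp (- r * S n \<omega>) * (C / (r + C))" using assms C_pos by simp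
  qed
  also have "\<dots> = expectation (\<lambda>\<omega>. exp (- r * S n \<omega>)) * (C / (r + C))"
    by (rule integral_mult_left_zero)
  also have "\<dots> \<le> (C / (r + C)) ^ n * (C / (r + C))"
    using Suc.IH assms C_pos by (intro mult_right_mono) auto
  finally show ?case by (simp add: mult_ac)
qed (simp add: prob_space)

lemma tendsto_rate_power:
  assumes "0 < r"
  shows "(\<lambda>n. (C / (r + C)) ^ n) \<longlonglongrightarrow> 0"
  using assms C_pos by (intro LIMSEQ_realpow_zero) auto

text \<open>If all jump times stay below \<open>K\<close>, then \<open>exp (- S n)\<close> is at
  least \<open>exp (- K)\<close> for every \<open>n\<close>, while its expectation tends to
  0.\<close>

lemma AE_no_explosion: "AE \<omega> in M. \<forall>K :: nat. \<exists>n. real K < S n \<omega>"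
proof (subst AE_all_countable, intro allI)
  fix K :: nat
  define E where "E = {\<omega> \<in> space M. \<forall>n. S n \<omega> \<le> real K}"
  have [measurable]: "E \<in> sets M" unfolding E_def by measurable
  have "prob E \<le> exp (real K) * (C / (1 + C)) ^ n" for n
  proof -
    have "exp (- real K) * prob E = expectation (\<lambda>\<omega>. exp (- real K) * indicator E \<omega>)"
      by simp
    also have "\<dots> \<le> expectation (\<lambda>\<omega>. exp (- 1 * S n \<omega>))"
      by (rule integral_mono'[OF integrable_exp_S]) (auto simp: E_def indicator_def)
    also have "\<dots> \<le> (C / (1 + C)) ^ n"
      by (rule expectation_exp_S_le) simp
    finally show ?thesis by (simp add: exp_minus field_simps)
  qed
  moreover have "(\<lambda>n. exp (real K) * (C / (1 + C)) ^ n) \<longlonglongrightarrow> exp (real K) * 0"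
    by (intro tendsto_intros tendsto_rate_power) auto
  ultimately have "prob E \<le> exp (real K) * 0"
    by (intro LIMSEQ_le_const) blast+
  hence "prob E = 0" using measure_nonneg[of M E] by linarith
  hence "AE \<omega> in M. \<omega> \<notin> E" by (subst (asm) prob_eq_0) auto
  with AE_space show "AE \<omega> in M. \<exists>n. real K < S n \<omega>"
    by eventually_elim (auto simp: E_def not_le)
qed

section \<open>Dynkin's formula up to a fixed number of jumps\<close>

definition dynkin_term :: "complex \<Rightarrow> 'b set \<Rightarrow> ('b \<Rightarrow> complex) \<Rightarrow> nat \<Rightarrow> 'a \<Rightarrow> complex" where
  "dynkin_term a D f n \<omega> = indicator (alive D n) \<omega> *
     (resolvent_op a f (Y n \<omega>) * ((exp (- a * of_real (S n \<omega>)) - exp (- a * of_real (S (Suc n) \<omega>))) / a) +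
      exp (- a * of_real (S (Suc n) \<omega>)) * (if Y (Suc n) \<omega> \<in> D then 0 else f (Y (Suc n) \<omega>)))"

lemma integrable_exp_alive:
  assumes "0 < Re a" "\<And>x y. cmod (f x y) \<le> B"
  shows "integrable M (\<lambda>\<omega>. exp (- a * of_real (S n \<omega>)) * (indicator (alive D m) \<omega> * f (Y k \<omega>) (Y l \<omega>)))"
proof (rule integrable_const_bound[where B = B])
  show "AE \<omega> in M. cmod (exp (- a * of_real (S n \<omega>)) * (indicator (alive D m) \<omega> * f (Y k \<omega>) (Y l \<omega>))) \<le> B"
    using AE_S_nonneg
  proof eventually_elim
    case (elim \<omega>)
    have "0 \<le> B" using assms(2)[of z z] norm_ge_zero[of "f z z"] by linarith
    hence "cmod (indicator (alive D m) \<omega> * f (Y k \<omega>) (Y l \<omega>)) \<le> B"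
      using assms(2) by (auto simp: indicator_def)
    moreover have "cmod (exp (- a * of_real (S n \<omega>))) \<le> 1" using assms(1) elim by (simp add: norm_exp_eq_Re)
    ultimately show ?case using \<open>0 \<le> B\<close> unfolding norm_mult[of "exp _"] by (smt (verit) mult_left_le_one_le norm_ge_zero)
  qed
qed measurable

lemma resolvent_op_bound:
  assumes "\<And>x. cmod (f x) \<le> B"
  shows "cmod (resolvent_op a f x) \<le> (cmod a + 2 * C) * B"
proof -
  have "0 \<le> B" using assms[of x] norm_ge_zero[of "f x"] by linarith
  have "cmod (resolvent_op a f x) \<le> cmod ((a + of_real (qout q x)) * f x) + cmod (\<Sum>y\<in>succs x. of_real (q x y) * f y)"
    unfolding resolvent_op_def by (rule norm_triangle_ineq4)
  also have "cmod ((a + of_real (qout q x)) * f x) \<le> (cmod a + C) * B"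
    unfolding norm_mult using assms[of x] qout_le[of x] qout_pos[of x] C_pos
    by (intro mult_mono order.trans[OF norm_triangle_ineq] add_mono) auto
  also have "cmod (\<Sum>y\<in>succs x. of_real (q x y) * f y) \<le> (\<Sum>y\<in>succs x. q x y * B)"
    using rate_nonneg assms by (intro sum_norm_le) (auto simp: norm_mult intro!: mult_left_mono)
  also have "\<dots> = qout q x * B" by (simp add: qout_eq_sum sum_distrib_right)
  also have "\<dots> \<le> C * B" using qout_le \<open>0 \<le> B\<close> by (intro mult_right_mono)
  finally show ?thesis by (simp add: algebra_simps)
qed

text \<open>One step of a telescoping sum. \<open>dynkin_term\<close> collects the discounted
  integral of \<open>resolvent_op a f\<close> over the \<open>n\<close>-th holding interval and the
  value of \<open>f\<close> picked up if the next jump leaves \<open>D\<close>; otherwise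
  \<open>f\<close> is carried to the next step.\<close>

lemma dynkin_step:
  assumes a: "0 < Re a" and f: "\<And>x. cmod (f x) \<le> B"
  shows "expectation (\<lambda>\<omega>. exp (- a * of_real (S n \<omega>)) * (indicator (alive D n) \<omega> * f (Y n \<omega>))) =
     expectation (dynkin_term a D f n) +
     expectation (\<lambda>\<omega>. exp (- a * of_real (S (Suc n) \<omega>)) * (indicator (alive D (Suc n)) \<omega> * f (Y (Suc n) \<omega>)))"
    and "integrable M (dynkin_term a D f n)"
proof -
  have [simp]: "a \<noteq> 0" using a by auto
  define h where "h = resolvent_op a f"
  have h: "cmod (h x) \<le> (cmod a + 2 * C) * B" for x
    unfolding h_def by (rule resolvent_op_bound[OF f])
  have aq: "a + of_real (qout q x) \<noteq> 0" for x
  proof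
    assume "a + of_real (qout q x) = 0"
    hence "Re a + qout q x = 0" by (auto simp: complex_eq_iff)
    thus False using a qout_pos[of x] by simp
  qed
  \<comment> \<open>The shift by \<open>h x / a\<close> absorbs the source: the discounted one-step
    average of \<open>f y - h x / a\<close> reproduces this expression at
    \<open>y = x\<close>.\<close>
  have u: "(\<Sum>y\<in>succs x. of_real (q x y) * (f y - h x / a)) / (a + of_real (qout q x)) = f x - h x / a" for x
  proof -
    have "(\<Sum>y\<in>succs x. of_real (q x y) * (f y - h x / a)) =
      (\<Sum>y\<in>succs x. of_real (q x y) * f y) - of_real (qout q x) * h x / a"
      by (simp add: qout_eq_sum right_diff_distrib sum_subtractf sum_distrib_right sum_divide_distrib)
    also have "(\<Sum>y\<in>succs x. of_real (q x y) * f y) = (a + of_real (qout q x)) * f x - h x"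
      by (simp add: h_def resolvent_op_def)
    also have "(a + of_real (qout q x)) * f x - h x - of_real (qout q x) * h x / a =
      (a + of_real (qout q x)) * (f x - h x / a)"
      by (simp add: field_simps)
    finally show ?thesis using aq by simp
  qed
  define A1 where "A1 = (\<lambda>\<omega>. exp (- a * of_real (S n \<omega>)) * (indicator (alive D n) \<omega> * (h (Y n \<omega>) / a)))"
  define A2 where "A2 = (\<lambda>\<omega>. exp (- a * of_real (S (Suc n) \<omega>)) * (indicator (alive D n) \<omega> * (f (Y (Suc n) \<omega>) - h (Y n \<omega>) / a)))"
  define A3 where "A3 = (\<lambda>\<omega>. exp (- a * of_real (S (Suc n) \<omega>)) * (indicator (alive D (Suc n)) \<omega> * f (Y (Suc n) \<omega>)))"
  define A0 where "A0 = (\<lambda>\<omega>. exp (- a * of_real (S n \<omega>)) * (indicator (alive D n) \<omega> * f (Y n \<omega>)))"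
  have int1: "integrable M A1" unfolding A1_def
    by (rule integrable_exp_alive[OF a, of "\<lambda>x y. h x / a" "((cmod a + 2 * C) * B) / cmod a"])
       (use h in \<open>auto simp: norm_divide intro!: divide_right_mono\<close>)
  have int2: "integrable M A2" unfolding A2_def
    by (rule integrable_exp_alive[OF a, of "\<lambda>x y. f y - h x / a" "B + ((cmod a + 2 * C) * B) / cmod a"])
       (use h f in \<open>auto simp: norm_divide intro!: divide_right_mono order.trans[OF norm_triangle_ineq4] add_mono\<close>)
  have int3: "integrable M A3" unfolding A3_def
    by (rule integrable_exp_alive[OF a, of "\<lambda>x y. f x" B]) (use f in auto)
  have int0: "integrable M A0" unfolding A0_def
    by (rule integrable_exp_alive[OF a, of "\<lambda>x y. f x" B]) (use f in auto)
  have eq: "dynkin_term a D f n = (\<lambda>\<omega>. A1 \<omega> + A2 \<omega> - A3 \<omega>)"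
  proof
    fix \<omega>
    have "indicator (alive D (Suc n)) \<omega> = (indicator (alive D n) \<omega> * (if Y (Suc n) \<omega> \<in> D then 1 else 0) :: complex)"
      by (auto simp: alive_def indicator_def le_Suc_eq)
    thus "dynkin_term a D f n \<omega> = A1 \<omega> + A2 \<omega> - A3 \<omega>"
      by (simp add: dynkin_term_def A1_def A2_def A3_def h_def field_simps)
  qed
  show "integrable M (dynkin_term a D f n)"
    unfolding eq by (intro Bochner_Integration.integrable_add Bochner_Integration.integrable_diff int1 int2 int3)
  have "expectation (dynkin_term a D f n) = expectation A1 + expectation A2 - expectation A3"
    unfolding eq by (simp add: int1 int2 int3)
  also have "expectation A2 = expectation (\<lambda>\<omega>. exp (- a * of_real (S n \<omega>)) * (indicator (alive D n) \<omega> * (f (Y n \<omega>) - h (Y n \<omega>) / a)))"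
    unfolding A2_def using markov_step[OF a, of n D "\<lambda>x y. f y - h x / a"] unfolding u .
  also have "\<dots> = expectation (\<lambda>\<omega>. A0 \<omega> - A1 \<omega>)"
    by (rule Bochner_Integration.integral_cong) (auto simp: A0_def A1_def algebra_simps)
  also have "\<dots> = expectation A0 - expectation A1" by (simp add: int0 int1)
  finally show "expectation (\<lambda>\<omega>. exp (- a * of_real (S n \<omega>)) * (indicator (alive D n) \<omega> * f (Y n \<omega>))) =
     expectation (dynkin_term a D f n) +
     expectation (\<lambda>\<omega>. exp (- a * of_real (S (Suc n) \<omega>)) * (indicator (alive D (Suc n)) \<omega> * f (Y (Suc n) \<omega>)))"
    unfolding A0_def A3_def by simp
qed

lemma dynkin_partial_sum:
  assumes a: "0 < Re a" and f: "\<And>x. cmod (f x) \<le> B" and "z \<in> D"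
  shows "f z = expectation (\<lambda>\<omega>. \<Sum>n<K. dynkin_term a D f n \<omega>) +
     expectation (\<lambda>\<omega>. exp (- a * of_real (S K \<omega>)) * (indicator (alive D K) \<omega> * f (Y K \<omega>)))"
proof (induction K)
  case 0
  have "expectation (\<lambda>\<omega>. exp (- a * of_real (S 0 \<omega>)) * (indicator (alive D 0) \<omega> * f (Y 0 \<omega>))) = expectation (\<lambda>_. f z)"
  proof (rule integral_cong_AE)
    show "AE \<omega> in M. exp (- a * of_real (S 0 \<omega>)) * (indicator (alive D 0) \<omega> * f (Y 0 \<omega>)) = f z"
      using AE_start AE_space by eventually_elim (use \<open>z \<in> D\<close> in \<open>auto simp: alive_def\<close>)
  qed measurable
  thus ?case by (simp add: prob_space)
next
  case (Suc K)
  have "integrable M (\<lambda>\<omega>. \<Sum>n<K. dynkin_term a D f n \<omega>)"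
    by (intro Bochner_Integration.integrable_sum dynkin_step(2)[OF a f])
  thus ?case using Suc.IH dynkin_step(2)[where f = f and n = K and D = D, OF a f] dynkin_step(1)[where f = f and n = K and D = D, OF a f] by simp
qed

text \<open>The remainder after \<open>K\<close> jumps is at most \<open>B\<close> times the
  expectation of \<open>exp (- Re a * S K)\<close>, which decays geometrically.\<close>

lemma dynkin_limit:
  assumes a: "0 < Re a" and f: "\<And>x. cmod (f x) \<le> B" and "z \<in> D"
  shows "(\<lambda>K. expectation (\<lambda>\<omega>. \<Sum>n<K. dynkin_term a D f n \<omega>)) \<longlonglongrightarrow> f z"
proof -
  have "0 \<le> B" using f[of z] norm_ge_zero[of "f z"] by linarith
  define R where "R K = expectation (\<lambda>\<omega>. exp (- a * of_real (S K \<omega>)) * (indicator (alive D K) \<omega> * f (Y K \<omega>)))" for K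
  have "cmod (R K) \<le> (C / (Re a + C)) ^ K * B" for K
  proof -
    have "cmod (R K) \<le> expectation (\<lambda>\<omega>. cmod (exp (- a * of_real (S K \<omega>)) * (indicator (alive D K) \<omega> * f (Y K \<omega>))))"
      unfolding R_def by (rule integral_norm_bound)
    also have "\<dots> \<le> expectation (\<lambda>\<omega>. exp (- Re a * S K \<omega>) * B)"
    proof (rule integral_mono')
      show "integrable M (\<lambda>\<omega>. exp (- Re a * S K \<omega>) * B)"
        by (rule integrable_mult_left[OF integrable_exp_S[OF a]])
      fix \<omega>
      show "cmod (exp (- a * of_real (S K \<omega>)) * (indicator (alive D K) \<omega> * f (Y K \<omega>))) \<le> exp (- Re a * S K \<omega>) * B"
        unfolding norm_mult[of "exp _"] using f \<open>0 \<le> B\<close>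
        by (intro mult_mono) (auto simp: norm_exp_eq_Re indicator_def)
    qed (use \<open>0 \<le> B\<close> in auto)
    also have "\<dots> = expectation (\<lambda>\<omega>. exp (- Re a * S K \<omega>)) * B"
      by (rule integral_mult_left_zero)
    also have "\<dots> \<le> (C / (Re a + C)) ^ K * B"
      using expectation_exp_S_le[OF a] \<open>0 \<le> B\<close> by (intro mult_right_mono) auto
    finally show ?thesis .
  qed
  moreover have "(\<lambda>K. (C / (Re a + C)) ^ K * B) \<longlonglongrightarrow> 0 * B"
    by (intro tendsto_intros tendsto_rate_power a)
  ultimately have "R \<longlonglongrightarrow> 0"
    by (intro Lim_null_comparison[of R]) (auto simp: always_eventually)
  hence "(\<lambda>K. f z - R K) \<longlonglongrightarrow> f z - 0" by (intro tendsto_intros)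
  moreover have "f z - R K = expectation (\<lambda>\<omega>. \<Sum>n<K. dynkin_term a D f n \<omega>)" for K
    using dynkin_partial_sum[where f = f and K = K, OF a f \<open>z \<in> D\<close>] by (simp add: R_def)
  ultimately show ?thesis by simp
qed

section \<open>Pathwise description on almost every path\<close>

lemma ctmc_X_on_interval:
  assumes T: "\<And>n. 0 < T n \<omega>" and t: "S n \<omega> \<le> t" "t < S (Suc n) \<omega>"
  shows "ctmc_X Y T t \<omega> = Y n \<omega>"
proof (rule ctmc_X_eqI)
  have S_eq: "(\<Sum>k\<le>m. T k \<omega>) = S (Suc m) \<omega>" for m
    by (simp add: S_def lessThan_Suc_atMost)
  show "t < (\<Sum>k\<le>n. T k \<omega>)" using t by (simp add: S_eq)
  have "incseq (\<lambda>n. S n \<omega>)" using T by (intro incseq_SucI) (simp add: S_Suc less_imp_le)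
  hence "S (Suc m) \<omega> \<le> S n \<omega>" if "m < n" for m using that by (simp add: incseq_def)
  thus "(\<Sum>k\<le>m. T k \<omega>) \<le> t" if "m < n" for m
    unfolding S_eq using t(1) that by (meson order.trans)
qed

lemma index_exists:
  assumes "\<forall>K :: nat. \<exists>n. real K < S n \<omega>" "0 \<le> t"
  obtains n where "S n \<omega> \<le> t" "t < S (Suc n) \<omega>"
proof -
  obtain K :: nat where "t < real K" using reals_Archimedean2 by blast
  then obtain m where m: "t < S m \<omega>" using assms(1) by (meson less_trans)
  define N where "N = (LEAST m. t < S m \<omega>)"
  have N: "t < S N \<omega>" unfolding N_def using m by (rule LeastI)
  with assms(2) obtain n where n: "N = Suc n" by (cases N) auto
  have "\<not> t < S n \<omega>" unfolding N_def by (rule not_less_Least) (use n in \<open>simp add: N_def\<close>)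
  with N n show ?thesis by (intro that[of n]) auto
qed

definition regular :: "'a \<Rightarrow> bool" where
  "regular \<omega> \<longleftrightarrow> \<omega> \<in> space M \<and> Y 0 \<omega> = z \<and> (\<forall>n. Y (Suc n) \<omega> \<in> succs (Y n \<omega>)) \<and> (\<forall>n. 0 < T n \<omega>) \<and>
     (\<forall>K :: nat. \<exists>n. real K < S n \<omega>)"

lemma AE_regular: "AE \<omega> in M. regular \<omega>"
  using AE_path AE_no_explosion AE_space by eventually_elim (auto simp: regular_def)

lemma regular_mono:
  assumes "regular \<omega>" "m \<le> n"
  shows "S m \<omega> \<le> S n \<omega>"
proof -
  have "incseq (\<lambda>n. S n \<omega>)"
    using assms by (intro incseq_SucI) (simp add: S_Suc regular_def less_imp_le)
  thus ?thesis using assms(2) by (simp add: incseq_def)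
qed

lemma regular_nonneg: "regular \<omega> \<Longrightarrow> 0 \<le> S n \<omega>"
  using regular_mono[of \<omega> 0 n] by simp

lemma regular_less_Suc: "regular \<omega> \<Longrightarrow> S n \<omega> < S (Suc n) \<omega>"
  by (simp add: regular_def S_Suc)

lemma regular_ctmc_X:
  "regular \<omega> \<Longrightarrow> S n \<omega> \<le> t \<Longrightarrow> t < S (Suc n) \<omega> \<Longrightarrow> ctmc_X Y T t \<omega> = Y n \<omega>"
  by (rule ctmc_X_on_interval) (auto simp: regular_def)

lemma regular_index:
  assumes "regular \<omega>" "0 \<le> t"
  obtains n where "S n \<omega> \<le> t" "t < S (Suc n) \<omega>"
  using assms by (auto simp: regular_def intro: index_exists)

lemma regular_index_unique:
  assumes "regular \<omega>" "S n \<omega> \<le> t" "t < S (Suc n) \<omega>" "S m \<omega> \<le> t" "t < S (Suc m) \<omega>"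
  shows "m = n"
proof (rule ccontr)
  assume "m \<noteq> n"
  then consider "Suc m \<le> n" | "Suc n \<le> m" by linarith
  thus False using regular_mono[OF assms(1), of "Suc m" n] regular_mono[OF assms(1), of "Suc n" m] assms
    by cases auto
qed

text \<open>Inside a holding interval the path is constant to the left, and at its end the state
  really changes because \<open>rate_diag\<close> forbids self-loops. The initial state never counts
  as an entrance, hence the index \<open>Suc n\<close>.\<close>

lemma regular_jumps_into_iff:
  assumes reg: "regular \<omega>"
  shows "jumps_into Y T A t \<omega> \<longleftrightarrow> (\<exists>n. t = S (Suc n) \<omega> \<and> Y (Suc n) \<omega> \<in> A)"
proof
  assume j: "jumps_into Y T A t \<omega>"
  hence t: "0 < t" by (simp add: jumps_into_def)
  then obtain n where n: "S n \<omega> \<le> t" "t < S (Suc n) \<omega>"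
    using regular_index[OF reg, of t] by auto
  have "t = S n \<omega>"
  proof (rule ccontr)
    assume "t \<noteq> S n \<omega>"
    with n have less: "S n \<omega> < t" by simp
    have "ctmc_X Y T s \<omega> = Y n \<omega>" if "S n \<omega> < s" "s \<le> t" for s
      by (rule regular_ctmc_X[OF reg]) (use that n in auto)
    hence "\<not> jumps_into Y T A t \<omega>"
      using less by (intro not_jumps_into_if_left_constant[OF less]) simp
    with j show False by contradiction
  qed
  moreover from this t obtain m where "n = Suc m" by (cases n) auto
  ultimately show "\<exists>n. t = S (Suc n) \<omega> \<and> Y (Suc n) \<omega> \<in> A"
    using j regular_ctmc_X[OF reg n] by (auto simp: jumps_into_def)
next
  assume "\<exists>n. t = S (Suc n) \<omega> \<and> Y (Suc n) \<omega> \<in> A"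
  then obtain n where n: "t = S (Suc n) \<omega>" "Y (Suc n) \<omega> \<in> A" by blast
  have X: "ctmc_X Y T t \<omega> = Y (Suc n) \<omega>"
    using n regular_less_Suc[OF reg, of "Suc n"] by (intro regular_ctmc_X[OF reg]) auto
  have "eventually (\<lambda>s. ctmc_X Y T s \<omega> = Y n \<omega>) (at_left t)"
    using regular_less_Suc[OF reg, of n] n
    by (auto simp: eventually_at_left_field intro!: exI[of _ "S n \<omega>"] regular_ctmc_X[OF reg])
  hence "Lim (at_left t) (\<lambda>s. ctmc_X Y T s \<omega>) = Y n \<omega>"
    by (intro tendsto_Lim tendsto_eventually) auto
  moreover have "Y n \<omega> \<noteq> Y (Suc n) \<omega>"
    using reg rate_diag[of "Y n \<omega>"] by (auto simp: regular_def succs_def dest!: spec[of _ n])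
  moreover have "0 < t" using n regular_less_Suc[OF reg, of n] regular_nonneg[OF reg, of n] by simp
  ultimately show "jumps_into Y T A t \<omega>" using X n by (simp add: jumps_into_def)
qed

lemma regular_hit_time_eq:
  assumes "regular \<omega>" "Y (Suc n) \<omega> \<in> A" "\<And>k. k < n \<Longrightarrow> Y (Suc k) \<omega> \<notin> A"
  shows "hit_time Y T A \<omega> = ereal (S (Suc n) \<omega>)"
  unfolding hit_time_eq
proof (rule antisym)
  show "Inf (ereal ` {t. jumps_into Y T A t \<omega>}) \<le> ereal (S (Suc n) \<omega>)"
    using assms by (intro Inf_lower) (auto simp: regular_jumps_into_iff)
  show "ereal (S (Suc n) \<omega>) \<le> Inf (ereal ` {t. jumps_into Y T A t \<omega>})"
  proof (rule Inf_greatest, safe)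
    fix t assume "jumps_into Y T A t \<omega>"
    then obtain m where m: "t = S (Suc m) \<omega>" "Y (Suc m) \<omega> \<in> A"
      using assms(1) by (auto simp: regular_jumps_into_iff)
    hence "n \<le> m" using assms(3)[of m] by (meson not_less)
    thus "ereal (S (Suc n) \<omega>) \<le> ereal t" using regular_mono[OF assms(1)] m by simp
  qed
qed

lemma regular_hit_time_infinity:
  assumes "regular \<omega>" "\<And>k. Y (Suc k) \<omega> \<notin> A"
  shows "hit_time Y T A \<omega> = \<infinity>"
  using assms by (simp add: hit_time_eq regular_jumps_into_iff top_ereal_def)

text \<open>During the \<open>n\<close>-th holding interval exactly the jumps to \<open>Y 1\<close>,
  ..., \<open>Y n\<close> have occurred, so \<open>k < n\<close> ranges over all entrances so far
  and skips the starting state.\<close>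

lemma regular_before_hit_iff:
  assumes reg: "regular \<omega>" and t: "S n \<omega> \<le> t" "t < S (Suc n) \<omega>"
  shows "ereal t < hit_time Y T A \<omega> \<longleftrightarrow> (\<forall>k<n. Y (Suc k) \<omega> \<notin> A)"
proof (cases "\<exists>k. Y (Suc k) \<omega> \<in> A")
  case True
  define N where "N = (LEAST k. Y (Suc k) \<omega> \<in> A)"
  have N: "Y (Suc N) \<omega> \<in> A" using LeastI_ex[OF True] by (simp add: N_def)
  have N': "Y (Suc k) \<omega> \<notin> A" if "k < N" for k using not_less_Least[of k "\<lambda>k. Y (Suc k) \<omega> \<in> A"] that by (simp add: N_def)
  have "ereal t < hit_time Y T A \<omega> \<longleftrightarrow> t < S (Suc N) \<omega>"
    using regular_hit_time_eq[OF reg N N'] by simp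
  also have "\<dots> \<longleftrightarrow> n \<le> N"
    using regular_mono[OF reg, of "Suc n" "Suc N"] regular_mono[OF reg, of "Suc N" n] t
    by (cases "n \<le> N") auto
  also have "\<dots> \<longleftrightarrow> (\<forall>k<n. Y (Suc k) \<omega> \<notin> A)"
    using N N' by (metis leI less_le_trans)
  finally show ?thesis .
next
  case False
  thus ?thesis using regular_hit_time_infinity[OF reg] by simp
qed

section \<open>Occupation integrals and exit terms in the limit\<close>

definition occupation :: "'b set \<Rightarrow> ('b \<Rightarrow> complex) \<Rightarrow> complex \<Rightarrow> 'a \<Rightarrow> complex" where
  "occupation A h a \<omega> = (LINT t:{t. 0 \<le> t \<and> ereal t < hit_time Y T A \<omega>}|lborel. exp (- a * of_real t) * h (ctmc_X Y T t \<omega>))"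

lemma measurable_hit_time' [measurable]: "hit_time Y T A \<in> borel_measurable M"
  by (rule measurable_hit_time[OF discrete]) measurable

lemma measurable_occupation [measurable]: "occupation A h a \<in> borel_measurable M"
  unfolding occupation_def[abs_def] set_lebesgue_integral_def
  by (rule lborel.borel_measurable_lebesgue_integral) (unfold indicator_def mem_Collect_eq, measurable)

lemma measurable_disc_hit_time [measurable]: "(\<lambda>\<omega>. disc a (hit_time Y T A \<omega>)) \<in> borel_measurable M"
  unfolding disc_def by measurable

definition occupation_sum :: "complex \<Rightarrow> 'b set \<Rightarrow> ('b \<Rightarrow> complex) \<Rightarrow> nat \<Rightarrow> 'a \<Rightarrow> complex" where
  "occupation_sum a D f K \<omega> = (\<Sum>n<K. indicator (alive D n) \<omega> * (resolvent_op a f (Y n \<omega>) *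
     ((exp (- a * of_real (S n \<omega>)) - exp (- a * of_real (S (Suc n) \<omega>))) / a)))"

definition exit_sum :: "complex \<Rightarrow> 'b set \<Rightarrow> ('b \<Rightarrow> complex) \<Rightarrow> nat \<Rightarrow> 'a \<Rightarrow> complex" where
  "exit_sum a D f K \<omega> = (\<Sum>n<K. indicator (alive D n) \<omega> *
     (exp (- a * of_real (S (Suc n) \<omega>)) * (if Y (Suc n) \<omega> \<in> D then 0 else f (Y (Suc n) \<omega>))))"

lemma dynkin_term_sum: "(\<Sum>n<K. dynkin_term a D f n \<omega>) = occupation_sum a D f K \<omega> + exit_sum a D f K \<omega>"
  by (simp add: dynkin_term_def occupation_sum_def exit_sum_def distrib_left sum.distrib)

text \<open>Leaving \<open>D\<close> means landing in \<open>A\<close>, so survival in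
  \<open>D\<close> and not yet having hit \<open>A\<close> are the same event. The resolvent
  equation is required on \<open>D\<close> alone, and the constancy of \<open>f\<close> on
  \<open>A\<close> lets the exit value leave the expectation.\<close>

context
  fixes D A :: "'b set" and f h :: "'b \<Rightarrow> complex" and B B' :: real and a c :: complex
  assumes a: "0 < Re a" and f: "\<And>x. cmod (f x) \<le> B" and h: "\<And>x. cmod (h x) \<le> B'"
    and fh: "\<And>x. x \<in> D \<Longrightarrow> resolvent_op a f x = h x" and z: "z \<in> D" and disj: "A \<inter> D = {}"
    and exit: "\<And>x y. x \<in> D \<Longrightarrow> y \<in> succs x \<Longrightarrow> y \<notin> D \<Longrightarrow> y \<in> A" and fA: "\<And>y. y \<in> A \<Longrightarrow> f y = c"
begin

lemma regular_alive_iff: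
  assumes "regular \<omega>"
  shows "\<omega> \<in> alive D n \<longleftrightarrow> (\<forall>k<n. Y (Suc k) \<omega> \<notin> A)"
proof (induction n)
  case 0
  thus ?case using assms z by (auto simp: alive_def regular_def)
next
  case (Suc n)
  have "\<omega> \<in> alive D (Suc n) \<longleftrightarrow> \<omega> \<in> alive D n \<and> Y (Suc n) \<omega> \<in> D"
    by (auto simp: alive_def le_Suc_eq)
  also have "\<dots> \<longleftrightarrow> \<omega> \<in> alive D n \<and> Y (Suc n) \<omega> \<notin> A"
    using exit[of "Y n \<omega>" "Y (Suc n) \<omega>"] assms disj by (auto simp: alive_def regular_def)
  finally show ?case using Suc.IH by (auto simp: less_Suc_eq)
qed

text \<open>At most one summand is nonzero, the one at the first entrance into \<open>A\<close>. If
  there is none, all vanish, matching the value 0 of \<open>disc\<close> at infinity.\<close>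

lemma exit_sum_regular:
  assumes reg: "regular \<omega>"
  shows "(\<lambda>K. exit_sum a D f K \<omega>) \<longlonglongrightarrow> c * disc a (hit_time Y T A \<omega>)" and "cmod (exit_sum a D f K \<omega>) \<le> B"
proof -
  have B: "0 \<le> B" using f[of z] norm_ge_zero[of "f z"] by linarith
  have eq: "exit_sum a D f K \<omega> = (\<Sum>n<K. if (\<forall>k<n. Y (Suc k) \<omega> \<notin> A) \<and> Y (Suc n) \<omega> \<in> A then c * exp (- a * of_real (S (Suc n) \<omega>)) else 0)" for K
    unfolding exit_sum_def
  proof (rule sum.cong)
    fix n
    have "\<omega> \<in> alive D n \<Longrightarrow> Y (Suc n) \<omega> \<notin> D \<Longrightarrow> Y (Suc n) \<omega> \<in> A"
      using exit[of "Y n \<omega>" "Y (Suc n) \<omega>"] reg by (auto simp: alive_def regular_def)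
    thus "indicator (alive D n) \<omega> *
     (exp (- a * of_real (S (Suc n) \<omega>)) * (if Y (Suc n) \<omega> \<in> D then 0 else f (Y (Suc n) \<omega>))) =
     (if (\<forall>k<n. Y (Suc k) \<omega> \<notin> A) \<and> Y (Suc n) \<omega> \<in> A then c * exp (- a * of_real (S (Suc n) \<omega>)) else 0)"
      using disj fA by (auto simp: regular_alive_iff[OF reg, symmetric])
  qed simp
  have "(\<lambda>K. exit_sum a D f K \<omega>) \<longlonglongrightarrow> c * disc a (hit_time Y T A \<omega>) \<and> cmod (exit_sum a D f K \<omega>) \<le> B"
  proof (cases "\<exists>k. Y (Suc k) \<omega> \<in> A")
    case True
    define N where "N = (LEAST k. Y (Suc k) \<omega> \<in> A)"
    have N: "Y (Suc N) \<omega> \<in> A" using LeastI_ex[OF True] by (simp add: N_def)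
    have N': "Y (Suc k) \<omega> \<notin> A" if "k < N" for k using not_less_Least[of k "\<lambda>k. Y (Suc k) \<omega> \<in> A"] that by (simp add: N_def)
    have "(\<forall>k<n. Y (Suc k) \<omega> \<notin> A) \<and> Y (Suc n) \<omega> \<in> A \<longleftrightarrow> n = N" for n
      using N N' linorder_neqE_nat[of n N] by blast
    hence eq': "exit_sum a D f K \<omega> = (if N < K then c * exp (- a * of_real (S (Suc N) \<omega>)) else 0)" for K
      unfolding eq by (simp add: sum.delta)
    have disc: "disc a (hit_time Y T A \<omega>) = exp (- a * of_real (S (Suc N) \<omega>))"
      by (simp add: regular_hit_time_eq[OF reg N N'] disc_def)
    have "cmod (exp (- a * of_real (S (Suc N) \<omega>))) \<le> 1"
      using a regular_nonneg[OF reg, of "Suc N"] by (simp add: norm_exp_eq_Re)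
    moreover have "cmod c \<le> B" using f[of "Y (Suc N) \<omega>"] fA[OF N] by simp
    ultimately have "cmod (c * exp (- a * of_real (S (Suc N) \<omega>))) \<le> B * 1"
      unfolding norm_mult using B by (intro mult_mono) auto
    moreover have "eventually (\<lambda>K. exit_sum a D f K \<omega> = c * disc a (hit_time Y T A \<omega>)) sequentially"
      using eventually_gt_at_top[of N] by eventually_elim (simp add: eq' disc)
    ultimately show ?thesis using B by (auto simp: eq' intro: tendsto_eventually)
  next
    case False
    thus ?thesis using regular_hit_time_infinity[OF reg, of A] B by (simp add: eq disc_def)
  qed
  thus "(\<lambda>K. exit_sum a D f K \<omega>) \<longlonglongrightarrow> c * disc a (hit_time Y T A \<omega>)" "cmod (exit_sum a D f K \<omega>) \<le> B" by auto
qed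

text \<open>The holding intervals of a regular path partition the half-line, and each summand is the
  integral of \<open>F\<close> over one of them. The bound is the same for all paths, as dominated
  convergence over the sample space requires.\<close>

lemma occupation_sum_regular:
  assumes reg: "regular \<omega>"
  shows "(\<lambda>K. occupation_sum a D f K \<omega>) \<longlonglongrightarrow> occupation A h a \<omega>"
    and "cmod (occupation_sum a D f K \<omega>) \<le> (\<integral>t. indicator {0..} t *\<^sub>R (cmod (exp (- a * of_real t)) * B') \<partial>lborel)"
proof -
  have [simp]: "a \<noteq> 0" using a by auto
  have B': "0 \<le> B'" using h[of z] norm_ge_zero[of "h z"] by linarith
  have \<omega>: "\<omega> \<in> space M" using reg by (simp add: regular_def)
  define g where "g n t = (indicator (alive D n) \<omega> * h (Y n \<omega>)) * (indicator {S n \<omega>..<S (Suc n) \<omega>} t *\<^sub>R exp (- a * of_real t))" for n t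
  define w where "w t = indicator {0..} t *\<^sub>R (cmod (exp (- a * of_real t)) * B')" for t
  define F where "F t = indicator {t. 0 \<le> t \<and> ereal t < hit_time Y T A \<omega>} t *\<^sub>R (exp (- a * of_real t) * h (ctmc_X Y T t \<omega>))" for t
  have F: "F t = (\<Sum>n<K. g n t)" if K: "S m \<omega> \<le> t" "t < S (Suc m) \<omega>" "m < K" for m t K
  proof -
    have "(\<Sum>n<K. g n t) = (\<Sum>n<K. if n = m then g m t else 0)"
      using regular_index_unique[OF reg K(1,2)] by (intro sum.cong) (auto simp: g_def indicator_def)
    also have "\<dots> = g m t" using K by simp
    also have "\<dots> = F t"
      using K regular_nonneg[OF reg, of m]
      by (simp add: F_def g_def regular_ctmc_X[OF reg K(1,2)] indicator_def regular_before_hit_iff[OF reg K(1,2)] regular_alive_iff[OF reg])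
    finally show ?thesis ..
  qed
  have G0: "(\<Sum>n<K. g n t) = 0" if "t < 0" for t K
  proof (intro sum.neutral ballI)
    fix n
    show "g n t = 0" using that regular_nonneg[OF reg, of n] by (simp add: g_def)
  qed
  have G1: "(\<Sum>n<K. g n t) = 0" if "S m \<omega> \<le> t" "t < S (Suc m) \<omega>" "K \<le> m" for t K m
    using regular_index_unique[OF reg that(1,2)] that(3) by (intro sum.neutral) (auto simp: g_def indicator_def)
  have gw: "cmod (\<Sum>n<K. g n t) \<le> w t" for K t
  proof (cases "0 \<le> t")
    case True
    then obtain m where m: "S m \<omega> \<le> t" "t < S (Suc m) \<omega>" using regular_index[OF reg] by blast
    show ?thesis
    proof (cases "m < K")
      case True
      have "cmod (F t) \<le> w t"
        using h \<open>0 \<le> t\<close> B' by (auto simp: F_def w_def indicator_def norm_mult intro!: mult_left_mono)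
      thus ?thesis using F[OF m True] by simp
    next
      case False
      thus ?thesis using G1[OF m] B' by (simp add: w_def)
    qed
  next
    case False
    thus ?thesis using G0 B' by (simp add: w_def)
  qed
  have intw: "integrable lborel w"
    using integrable_mult_left[OF integrable_norm[OF integrable_exp_neg_mult_Ici[OF a, unfolded set_integrable_def]], of B']
    unfolding w_def by (simp add: norm_mult mult_ac)
  have [measurable]: "F \<in> borel_measurable lborel"
    unfolding F_def indicator_def mem_Collect_eq using \<omega> by measurable
  have [measurable]: "g n \<in> borel_measurable lborel" for n unfolding g_def by measurable
  have intg: "integrable lborel (g n)" for n
  proof (rule Bochner_Integration.integrable_bound[OF intw])
    show "AE t in lborel. cmod (g n t) \<le> norm (w t)"
    proof (rule AE_I2)
      fix t
      show "cmod (g n t) \<le> norm (w t)"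
        using h B' regular_nonneg[OF reg, of n]
        by (auto simp: g_def w_def indicator_def norm_mult mult.commute intro!: mult_left_mono)
    qed
  qed measurable
  have int: "(\<integral>t. (\<Sum>n<K. g n t) \<partial>lborel) = occupation_sum a D f K \<omega>" for K
  proof -
    have "(\<integral>t. (\<Sum>n<K. g n t) \<partial>lborel) = (\<Sum>n<K. \<integral>t. g n t \<partial>lborel)"
      by (rule Bochner_Integration.integral_sum) (rule intg)
    also have "\<dots> = occupation_sum a D f K \<omega>"
      unfolding occupation_sum_def
    proof (rule sum.cong)
      fix n
      have "(\<integral>t. g n t \<partial>lborel) = (indicator (alive D n) \<omega> * h (Y n \<omega>)) * ((exp (- a * of_real (S n \<omega>)) - exp (- a * of_real (S (Suc n) \<omega>))) / a)"
        unfolding g_def integral_mult_right_zero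
        using set_integral_exp_neg_mult_Ico[of a "S n \<omega>" "S (Suc n) \<omega>"] regular_less_Suc[OF reg, of n]
        by (simp add: set_lebesgue_integral_def)
      moreover have "indicator (alive D n) \<omega> * h (Y n \<omega>) = indicator (alive D n) \<omega> * resolvent_op a f (Y n \<omega>)"
        using fh[of "Y n \<omega>"] by (auto simp: indicator_def alive_def)
      ultimately show "(\<integral>t. g n t \<partial>lborel) = indicator (alive D n) \<omega> * (resolvent_op a f (Y n \<omega>) *
         ((exp (- a * of_real (S n \<omega>)) - exp (- a * of_real (S (Suc n) \<omega>))) / a))"
        by (simp only: mult.assoc)
    qed simp
    finally show ?thesis .
  qed
  have "(\<lambda>K. \<integral>t. (\<Sum>n<K. g n t) \<partial>lborel) \<longlonglongrightarrow> (\<integral>t. F t \<partial>lborel)"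
  proof (rule integral_dominated_convergence[where w = w])
    show "AE t in lborel. (\<lambda>K. \<Sum>n<K. g n t) \<longlonglongrightarrow> F t"
    proof (rule AE_I2)
      fix t
      show "(\<lambda>K. \<Sum>n<K. g n t) \<longlonglongrightarrow> F t"
      proof (cases "0 \<le> t")
        case True
        then obtain m where m: "S m \<omega> \<le> t" "t < S (Suc m) \<omega>" using regular_index[OF reg] by blast
        have "eventually (\<lambda>K. (\<Sum>n<K. g n t) = F t) sequentially"
          using eventually_gt_at_top[of m] by eventually_elim (use F[OF m] in auto)
        thus ?thesis by (rule tendsto_eventually)
      qed (simp add: G0 F_def)
    qed
  qed (use gw intw in auto)
  thus "(\<lambda>K. occupation_sum a D f K \<omega>) \<longlonglongrightarrow> occupation A h a \<omega>"
    unfolding int by (simp add: F_def occupation_def set_lebesgue_integral_def)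
  have "cmod (occupation_sum a D f K \<omega>) \<le> (\<integral>t. cmod (\<Sum>n<K. g n t) \<partial>lborel)"
    unfolding int[symmetric] by (rule integral_norm_bound)
  also have "\<dots> \<le> (\<integral>t. w t \<partial>lborel)"
    by (rule integral_mono'[OF intw]) (use gw order.trans[OF norm_ge_zero gw] in auto)
  finally show "cmod (occupation_sum a D f K \<omega>) \<le> (\<integral>t. indicator {0..} t *\<^sub>R (cmod (exp (- a * of_real t)) * B') \<partial>lborel)"
    unfolding w_def .
qed

lemma cmod_disc_le_1: "cmod (disc a (hit_time Y T A \<omega>)) \<le> 1"
proof -
  have "0 \<le> hit_time Y T A \<omega>"
    unfolding hit_time_eq by (intro Inf_greatest) (auto simp: jumps_into_def)
  thus ?thesis using a
    by (cases "hit_time Y T A \<omega>") (auto simp: disc_def norm_exp_eq_Re)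
qed

lemma dynkin_formula: "f z = expectation (occupation A h a) + c * expectation (\<lambda>\<omega>. disc a (hit_time Y T A \<omega>))"
proof -
  define W where "W = (\<integral>t. indicator {0..} t *\<^sub>R (cmod (exp (- a * of_real t)) * B') \<partial>lborel)"
  have int_occ: "integrable M (occupation A h a)"
  proof (rule integrable_const_bound[where B = W])
    show "AE \<omega> in M. cmod (occupation A h a \<omega>) \<le> W"
      using AE_regular
    proof eventually_elim
      case (elim \<omega>)
      show ?case
        using tendsto_norm[OF occupation_sum_regular(1)[OF elim]] occupation_sum_regular(2)[OF elim]
        by (intro LIMSEQ_le_const2) (auto simp: W_def)
    qed
  qed measurable
  have int_disc: "integrable M (\<lambda>\<omega>. disc a (hit_time Y T A \<omega>))"
    by (rule integrable_const_bound[where B = 1]) (auto simp: cmod_disc_le_1)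
  have "(\<lambda>K. expectation (\<lambda>\<omega>. \<Sum>n<K. dynkin_term a D f n \<omega>)) \<longlonglongrightarrow> expectation (\<lambda>\<omega>. occupation A h a \<omega> + c * disc a (hit_time Y T A \<omega>))"
  proof (rule integral_dominated_convergence[where w = "\<lambda>_. W + B"])
    show "AE \<omega> in M. (\<lambda>K. \<Sum>n<K. dynkin_term a D f n \<omega>) \<longlonglongrightarrow> occupation A h a \<omega> + c * disc a (hit_time Y T A \<omega>)"
      using AE_regular
    proof eventually_elim
      case (elim \<omega>)
      show ?case unfolding dynkin_term_sum
        by (intro tendsto_add occupation_sum_regular exit_sum_regular elim)
    qed
    show "AE \<omega> in M. cmod (\<Sum>n<K. dynkin_term a D f n \<omega>) \<le> W + B" for K
      using AE_regular
    proof eventually_elim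
      case (elim \<omega>)
      show ?case unfolding dynkin_term_sum W_def
        by (intro order.trans[OF norm_triangle_ineq] add_mono occupation_sum_regular exit_sum_regular elim)
    qed
    show "(\<lambda>\<omega>. \<Sum>n<K. dynkin_term a D f n \<omega>) \<in> borel_measurable M" for K
      using borel_measurable_integrable[OF dynkin_step(2)[where f = f, OF a f]] by measurable
  qed auto
  moreover have "(\<lambda>K. expectation (\<lambda>\<omega>. \<Sum>n<K. dynkin_term a D f n \<omega>)) \<longlonglongrightarrow> f z"
    by (rule dynkin_limit[where f = f, OF a f z])
  ultimately have "f z = expectation (\<lambda>\<omega>. occupation A h a \<omega> + c * disc a (hit_time Y T A \<omega>))"
    by (rule LIMSEQ_unique[rotated])
  thus ?thesis using int_occ int_disc by simp
qed

end

section \<open>Consequences: transition transforms and exit transforms\<close>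

definition laplace_prob :: "complex \<Rightarrow> 'b \<Rightarrow> complex" where
  "laplace_prob a x = (LINT t:{0..}|lborel.
     exp (- a * of_real t) * of_real (prob {\<omega> \<in> space M. ctmc_X Y T t \<omega> = x}))"

text \<open>Dynkin's formula with \<open>A = {}\<close>: nothing is ever hit and the integral runs
  over the whole path. The source has finite support, and Fubini turns the discounted time in each
  of its states into the transform of the transition probability.\<close>

lemma resolvent_eq_sum_laplace_prob:
  assumes a: "0 < Re a" and f: "\<And>x. cmod (f x) \<le> B" and "finite F"
    and F: "\<And>x. x \<notin> F \<Longrightarrow> resolvent_op a f x = 0"
  shows "f z = (\<Sum>x\<in>F. resolvent_op a f x * laplace_prob a x)"
proof -
  interpret L: pair_sigma_finite lborel M ..
  define h where "h = resolvent_op a f"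
  have hF: "h x = (\<Sum>y\<in>F. h y * (if x = y then 1 else 0))" for x
    using F[of x] \<open>finite F\<close> by (cases "x \<in> F") (auto simp: h_def if_distrib cong: if_cong)
  have hit: "hit_time Y T {} \<omega> = \<infinity>" for \<omega>
    by (simp add: hit_time_def top_ereal_def)
  define k where "k y t \<omega> = indicator {0..} t *\<^sub>R (exp (- a * of_real t) * (if ctmc_X Y T t \<omega> = y then 1 else 0))" for y t \<omega>
  have [measurable]: "case_prod (k y) \<in> borel_measurable (lborel \<Otimes>\<^sub>M M)" for y
    unfolding k_def by measurable
  have k_norm: "cmod (k y t \<omega>) \<le> cmod (indicator {0..} t *\<^sub>R exp (- a * of_real t))" for y t \<omega>
    by (auto simp: k_def indicator_def)
  have inte: "integrable lborel (\<lambda>t. indicator {0..} t *\<^sub>R exp (- a * of_real t))"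
    using integrable_exp_neg_mult_Ici[OF a] by (simp add: set_integrable_def)
  have intM: "integrable M (\<lambda>\<omega>. k y t \<omega>)" for y t
    by (rule integrable_const_bound[OF AE_I2[OF k_norm]]) simp
  have int_pair: "integrable (lborel \<Otimes>\<^sub>M M) (case_prod (k y))" for y
  proof (rule L.Fubini_integrable)
    show "integrable lborel (\<lambda>t. \<integral>\<omega>. cmod (case_prod (k y) (t, \<omega>)) \<partial>M)"
    proof (rule Bochner_Integration.integrable_bound[OF inte])
      show "AE t in lborel. norm (\<integral>\<omega>. cmod (case_prod (k y) (t, \<omega>)) \<partial>M) \<le> cmod (indicator {0..} t *\<^sub>R exp (- a * of_real t))"
      proof (rule AE_I2)
        fix t
        have "(\<integral>\<omega>. cmod (k y t \<omega>) \<partial>M) \<le> (\<integral>\<omega>. cmod (indicator {0..} t *\<^sub>R exp (- a * of_real t)) \<partial>M)"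
          by (rule integral_mono'[OF _ k_norm]) auto
        thus "norm (\<integral>\<omega>. cmod (case_prod (k y) (t, \<omega>)) \<partial>M) \<le> cmod (indicator {0..} t *\<^sub>R exp (- a * of_real t))"
          by (simp add: prob_space)
      qed
    qed measurable
  qed (use intM in auto)
  have k_laplace: "(\<integral>t. (\<integral>\<omega>. k y t \<omega> \<partial>M) \<partial>lborel) = laplace_prob a y" for y
    unfolding laplace_prob_def set_lebesgue_integral_def
  proof (rule Bochner_Integration.integral_cong)
    fix t :: real
    have "(\<integral>\<omega>. k y t \<omega> \<partial>M) = (\<integral>\<omega>. (indicator {0..} t *\<^sub>R exp (- a * of_real t)) * of_real (indicator {\<omega> \<in> space M. ctmc_X Y T t \<omega> = y} \<omega>) \<partial>M)"
      by (rule Bochner_Integration.integral_cong) (auto simp: k_def indicator_def)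
    also have "\<dots> = (indicator {0..} t *\<^sub>R exp (- a * of_real t)) * of_real (prob {\<omega> \<in> space M. ctmc_X Y T t \<omega> = y})"
      unfolding integral_mult_right_zero integral_complex_of_real by simp
    finally show "(\<integral>\<omega>. k y t \<omega> \<partial>M) = indicator {0..} t *\<^sub>R (exp (- a * of_real t) * of_real (prob {\<omega> \<in> space M. ctmc_X Y T t \<omega> = y}))"
      by simp
  qed simp
  have "f z = expectation (occupation {} h a) + 0 * expectation (\<lambda>\<omega>. disc a (hit_time Y T {} \<omega>))"
    by (rule dynkin_formula[where D = UNIV and f = f and B = B, OF a f])
       (use resolvent_op_bound[of f B, OF f] in \<open>auto simp: h_def\<close>)
  also have "\<dots> = expectation (occupation {} h a)" by simp
  also have "\<dots> = expectation (\<lambda>\<omega>. \<Sum>y\<in>F. h y * (\<integral>t. k y t \<omega> \<partial>lborel))"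
  proof (rule integral_cong_AE)
    have "AE \<omega> in M. \<forall>y\<in>F. integrable lborel (\<lambda>t. k y t \<omega>)"
      using \<open>finite F\<close> L.AE_integrable_snd[OF int_pair] by (simp add: AE_finite_all)
    thus "AE \<omega> in M. occupation {} h a \<omega> = (\<Sum>y\<in>F. h y * (\<integral>t. k y t \<omega> \<partial>lborel))"
    proof eventually_elim
      case (elim \<omega>)
      have "occupation {} h a \<omega> = (\<integral>t. (\<Sum>y\<in>F. h y * k y t \<omega>) \<partial>lborel)"
        unfolding occupation_def hit set_lebesgue_integral_def
        by (rule Bochner_Integration.integral_cong, simp, subst hF)
           (auto simp: k_def indicator_def sum_distrib_left intro!: sum.cong)
      also have "\<dots> = (\<Sum>y\<in>F. \<integral>t. h y * k y t \<omega> \<partial>lborel)"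
        by (rule Bochner_Integration.integral_sum) (use elim in auto)
      finally show ?case unfolding integral_mult_right_zero .
    qed
  qed measurable
  also have "\<dots> = (\<Sum>y\<in>F. expectation (\<lambda>\<omega>. h y * (\<integral>t. k y t \<omega> \<partial>lborel)))"
    by (rule Bochner_Integration.integral_sum) (intro integrable_mult_right L.integrable_snd int_pair)
  also have "\<dots> = (\<Sum>y\<in>F. h y * laplace_prob a y)"
    unfolding integral_mult_right_zero
    by (intro sum.cong refl arg_cong2[where f = "(*)"]) (simp add: L.Fubini_integral[OF int_pair] flip: k_laplace)
  finally show ?thesis unfolding h_def .
qed

text \<open>With zero source the exit term of Dynkin's formula remains alone.\<close>

lemma exit_transform:
  assumes a: "0 < Re a" and f: "\<And>x. cmod (f x) \<le> B"
    and harm: "\<And>x. x \<in> D \<Longrightarrow> resolvent_op a f x = 0" and z: "z \<in> D" and disj: "A \<inter> D = {}"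
    and exit: "\<And>x y. x \<in> D \<Longrightarrow> y \<in> succs x \<Longrightarrow> y \<notin> D \<Longrightarrow> y \<in> A" and fA: "\<And>y. y \<in> A \<Longrightarrow> f y = 1"
  shows "expectation (\<lambda>\<omega>. disc a (hit_time Y T A \<omega>)) = f z"
proof -
  have "f z = expectation (occupation A (\<lambda>_. 0) a) + 1 * expectation (\<lambda>\<omega>. disc a (hit_time Y T A \<omega>))"
    by (rule dynkin_formula[where D = D and f = f and B = B and B' = 0, OF a f]) (use assms in auto)
  moreover have "occupation A (\<lambda>_. 0) a = (\<lambda>_. 0)"
    by (rule ext) (simp add: occupation_def set_lebesgue_integral_def)
  ultimately show ?thesis by simp
qed

end

section \<open>The quadratic equation of the busy period\<close>

text \<open>This keeps \<open>phi\<close> away from the branch cut of \<open>csqrt\<close>. A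
  nonpositive real discriminant would force \<open>b = l + m + s\<close> to be real because its real
  part is positive, but then \<open>b^2 > (l + m)^2 \<ge> 4 * l * m\<close>.\<close>

lemma phi_discriminant_notin_nonpos_Reals:
  assumes "0 < l" "0 < m" "0 < Re s"
  shows "(of_real l + of_real m + s)^2 - 4 * of_real l * of_real m \<notin> \<real>\<^sub>\<le>\<^sub>0"
proof
  define x where "x = l + m + Re s"
  define y where "y = Im s"
  assume "(of_real l + of_real m + s)^2 - 4 * of_real l * of_real m \<in> \<real>\<^sub>\<le>\<^sub>0"
  hence *: "x^2 - y^2 - 4 * l * m \<le> 0" "2 * x * y = 0"
    by (auto simp: complex_nonpos_Reals_iff x_def y_def power2_eq_square algebra_simps)
  have "0 < x" using assms by (simp add: x_def)
  with * have "x^2 \<le> 4 * l * m" by simp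
  moreover have "(l + m)^2 < x^2" using assms by (intro power_strict_mono) (auto simp: x_def)
  moreover have "4 * l * m \<le> (l + m)^2"
    using zero_le_power2[of "l - m"] by (simp add: power2_eq_square algebra_simps)
  ultimately show False by linarith
qed

lemma continuous_on_phi:
  assumes "0 < l" "0 < m"
  shows "continuous_on {s. 0 < Re s} (phi l m)"
proof -
  have "continuous_on {s. 0 < Re s} (\<lambda>s. csqrt ((of_real l + of_real m + s)^2 - 4 * of_real l * of_real m))"
    by (rule continuous_on_compose2[OF continuous_on_csqrt])
       (use assms in \<open>auto intro!: continuous_intros dest: phi_discriminant_notin_nonpos_Reals\<close>)
  thus ?thesis unfolding phi_def using assms by (intro continuous_intros) auto
qed

text \<open>The first-step equation of a busy period: a service ends it, an arrival replaces it by
  two consecutive busy periods.\<close>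

lemma phi_quadratic:
  assumes "l \<noteq> 0"
  shows "of_real l * phi l m s ^ 2 + of_real m = (of_real l + of_real m + s) * phi l m s"
proof -
  define b where "b = of_real l + of_real m + s"
  define r where "r = csqrt (b^2 - 4 * of_real l * of_real m)"
  have r: "r^2 = b^2 - 4 * of_real l * of_real m" unfolding r_def by simp
  have p: "phi l m s = (b - r) / (2 * of_real l)"
    by (simp add: phi_def b_def r_def)
  have "4 * of_real l * (of_real l * phi l m s ^ 2 + of_real m) = (b - r)^2 + 4 * of_real l * of_real m"
    using assms unfolding p by (simp add: power2_eq_square field_simps)
  also have "\<dots> = 2 * b * (b - r)" using r by (simp add: power2_eq_square algebra_simps)
  also have "\<dots> = 4 * of_real l * (b * phi l m s)" using assms unfolding p by (simp add: field_simps)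
  finally show ?thesis using assms by (simp add: b_def)
qed

text \<open>The two roots of the quadratic have product \<open>m / l\<close> and a sum of modulus larger than \<open>1 + m / l\<close>,
  so they lie on different sides of the unit circle; the choice of the principal square root
  makes \<^const>\<open>phi\<close> the smaller one.\<close>

lemma cmod_phi_le_1:
  assumes "0 < l" "0 < m" "0 < Re s"
  shows "cmod (phi l m s) \<le> 1"
proof (rule ccontr)
  assume "\<not> ?thesis"
  define b where "b = of_real l + of_real m + s"
  define r where "r = csqrt (b^2 - 4 * of_real l * of_real m)"
  define p where "p = (b - r) / (2 * of_real l)"
  define p' where "p' = (b + r) / (2 * of_real l)"
  have r: "r^2 = b^2 - 4 * of_real l * of_real m" unfolding r_def by simp
  have p: "phi l m s = p" by (simp add: phi_def b_def r_def p_def)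
  have prod: "p * p' = of_real (m / l)"
  proof -
    have "p * p' = (b^2 - r^2) / (4 * of_real l * of_real l)"
      by (simp add: p_def p'_def power2_eq_square algebra_simps)
    also have "\<dots> = of_real (m / l)" unfolding r using assms by simp
    finally show ?thesis .
  qed
  have sum: "p + p' = b / of_real l" using assms by (simp add: p_def p'_def field_simps)
  define x y u v where "x = Re b" and "y = Im b" and "u = Re r" and "v = Im r"
  have x: "0 < x" using assms by (simp add: x_def b_def)
  have u: "0 \<le> u" using csqrt_principal[of "b^2 - 4 * of_real l * of_real m"] by (auto simp: u_def r_def)
  have "Im (r^2) = Im (b^2)" unfolding r by simp
  hence uv: "u * v = x * y" by (simp add: u_def v_def x_def y_def power2_eq_square algebra_simps)
  \<comment> \<open>This is the real part of \<open>b * cnj r\<close>: \<open>b\<close> and the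
    principal root \<open>r\<close> enclose at most a right angle, so \<open>b - r\<close> is no
    longer than \<open>b + r\<close>.\<close>
  have "0 \<le> x * u + y * v"
  proof (cases "u = 0")
    case True
    with uv x show ?thesis by auto
  next
    case False
    with u have "0 < u" by simp
    have "u * (x * u + y * v) = x * u^2 + y * (u * v)" by (simp add: power2_eq_square algebra_simps)
    also have "\<dots> = x * (u^2 + y^2)" unfolding uv by (simp add: power2_eq_square algebra_simps)
    finally have "0 \<le> u * (x * u + y * v)" using x by simp
    with \<open>0 < u\<close> show ?thesis by (simp add: zero_le_mult_iff)
  qed
  hence "cmod (b - r) ^ 2 \<le> cmod (b + r) ^ 2"
    unfolding cmod_power2 by (simp add: x_def y_def u_def v_def power2_eq_square algebra_simps)
  hence "cmod (b - r) \<le> cmod (b + r)" by (rule power2_le_imp_le) simp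
  hence le: "cmod p \<le> cmod p'" using assms by (simp add: p_def p'_def norm_divide divide_right_mono)
  have "1 < cmod p" using \<open>\<not> _\<close> by (simp add: p)
  hence "0 < (cmod p - 1) * (cmod p' - 1)" using le by simp
  hence "cmod p + cmod p' < 1 + cmod (p * p')" by (simp add: norm_mult algebra_simps)
  also have "\<dots> = 1 + m / l" unfolding prod using assms by (simp del: of_real_divide)
  also have "\<dots> < Re b / l" using assms by (simp add: b_def field_simps)
  also have "\<dots> \<le> cmod b / l" using assms complex_Re_le_cmod by (intro divide_right_mono) auto
  also have "\<dots> = cmod (p + p')" unfolding sum using assms by (simp add: norm_divide)
  also have "\<dots> \<le> cmod p + cmod p'" by (rule norm_triangle_ineq)
  finally show False by simp
qed

text \<open>First-step analysis of the descent by one level on the axis: a class 1 arrival requires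
  two descents, a class 2 arrival a busy period whose class 1 arrivals each cost another
  \<open>g\<close>. On the closed unit disc \<open>phi\<close> has modulus at most 1, so
  \<open>Re (den g) > m1\<close> and \<open>m1 / den g\<close> maps the disc continuously into
  itself.\<close>

lemma exists_descent_transform:
  fixes l1 l2 m1 m2 :: real and \<alpha> :: complex
  assumes pos: "0 < l1" "0 < l2" "0 < m1" "0 < m2" and \<alpha>: "0 < Re \<alpha>"
  obtains g :: complex where "cmod g \<le> 1"
    "g * (\<alpha> + l1 + l2 + m1 - l1 * g - l2 * phi l2 m2 (of_real l1 * (1 - g) + \<alpha>)) = m1"
proof -
  define den where "den g = \<alpha> + l1 + l2 + m1 - l1 * g - l2 * phi l2 m2 (of_real l1 * (1 - g) + \<alpha>)" for g :: complex
  have arg: "0 < Re (of_real l1 * (1 - g) + \<alpha>)" if "cmod g \<le> 1" for g :: complex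
  proof -
    have "Re g \<le> 1" using complex_Re_le_cmod[of g] that by simp
    hence "0 \<le> l1 * (1 - Re g)" using pos by simp
    thus ?thesis using \<alpha> by simp
  qed
  have den: "m1 < cmod (den g)" if g: "cmod g \<le> 1" for g
  proof -
    define p where "p = phi l2 m2 (of_real l1 * (1 - g) + \<alpha>)"
    have "Re g \<le> 1" using complex_Re_le_cmod[of g] g by simp
    hence 1: "0 \<le> l1 * (1 - Re g)" using pos by simp
    have "cmod p \<le> 1" unfolding p_def using pos arg[OF g] by (intro cmod_phi_le_1)
    hence "Re p \<le> 1" using complex_Re_le_cmod[of p] by simp
    hence 2: "0 \<le> l2 * (1 - Re p)" using pos by simp
    have "Re (den g) = Re \<alpha> + l1 + l2 + m1 - l1 * Re g - l2 * Re p" by (simp add: den_def p_def)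
    hence "m1 < Re (den g)" using 1 2 \<alpha> by (simp add: algebra_simps)
    thus ?thesis using complex_Re_le_cmod[of "den g"] by simp
  qed
  have den0: "den g \<noteq> 0" if "cmod g \<le> 1" for g using den[OF that] pos by auto
  obtain g where g: "g \<in> cball (0 :: complex) 1" "of_real m1 / den g = g"
  proof (rule brouwer[of "cball (0 :: complex) 1" "\<lambda>g. of_real m1 / den g"])
    show "continuous_on (cball 0 1) (\<lambda>g. of_real m1 / den g)"
    proof -
      have "continuous_on (cball 0 1) (\<lambda>g. phi l2 m2 (of_real l1 * (1 - g) + \<alpha>))"
        by (rule continuous_on_compose2[OF continuous_on_phi])
           (use pos arg in \<open>auto intro!: continuous_intros\<close>)
      hence "continuous_on (cball 0 1) den"
        unfolding den_def by (intro continuous_intros)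
      thus ?thesis using den0 by (intro continuous_intros) auto
    qed
    show "(\<lambda>g. of_real m1 / den g) \<in> cball 0 1 \<rightarrow> cball 0 1"
    proof
      fix g :: complex assume "g \<in> cball 0 1"
      hence "m1 < cmod (den g)" by (intro den) simp
      thus "of_real m1 / den g \<in> cball 0 1" using pos by (simp add: norm_divide divide_simps)
    qed
  qed auto
  show ?thesis
  proof (rule that[of g])
    show "cmod g \<le> 1" using g by simp
    hence "g * den g = of_real m1" using g(2) den0[of g] by (simp add: divide_eq_eq)
    thus "g * (\<alpha> + l1 + l2 + m1 - l1 * g - l2 * phi l2 m2 (of_real l1 * (1 - g) + \<alpha>)) = m1"
      unfolding den_def .
  qed
qed

text \<open>The sum of absolute coefficients is submultiplicative under the Cauchy product.\<close>

lemma fps_nth_power_abs_sum_le_1: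
  fixes W :: "complex fps"
  assumes W: "\<And>L. (\<Sum>l<L. cmod (fps_nth W l)) \<le> 1"
  shows "(\<Sum>l<L. cmod (fps_nth (W ^ j) l)) \<le> 1"
proof (induction j)
  case 0
  have "(\<Sum>l<L. cmod (fps_nth (W ^ 0) l)) = (\<Sum>l<L. if l = 0 then 1 else 0)"
    by (intro sum.cong) auto
  also have "\<dots> \<le> 1" by (simp add: sum.delta)
  finally show ?case .
next
  case (Suc j)
  have "(\<Sum>l<L. cmod (fps_nth (W ^ Suc j) l)) \<le> (\<Sum>l<L. \<Sum>i\<le>l. cmod (fps_nth W i) * cmod (fps_nth (W ^ j) (l - i)))"
    by (intro sum_mono) (auto simp: fps_mult_nth atLeast0AtMost norm_mult intro!: order.trans[OF norm_sum])
  also have "\<dots> = (\<Sum>(i,k)\<in>{(i,k). i + k < L}. cmod (fps_nth W i) * cmod (fps_nth (W ^ j) k))"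
    by (rule sum.triangle_reindex[symmetric])
  also have "\<dots> \<le> (\<Sum>(i,k)\<in>{..<L} \<times> {..<L}. cmod (fps_nth W i) * cmod (fps_nth (W ^ j) k))"
    by (intro sum_mono2) auto
  also have "\<dots> = (\<Sum>i<L. cmod (fps_nth W i)) * (\<Sum>k<L. cmod (fps_nth (W ^ j) k))"
    by (simp add: sum_product sum.cartesian_product)
  also have "\<dots> \<le> 1 * 1"
    using W Suc.IH by (intro mult_mono) (auto intro: sum_nonneg)
  finally show ?case by simp
qed

text \<open>Uniqueness of power series turns the functional equation near 0 into an identity of
  coefficients.\<close>

lemma fps_eq_if_powser_quadratic:
  fixes W :: "complex fps" and p :: "complex \<Rightarrow> complex"
  assumes sums: "\<And>x. cmod x \<le> 1 \<Longrightarrow> (\<lambda>l. fps_nth W l * x ^ l) sums p x"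
    and quad: "\<And>x. cmod x \<le> 1 \<Longrightarrow> c * p x ^ 2 + d = (A - t * x) * p x"
  shows "fps_const A * W - fps_const t * fps_X * W = fps_const c * W ^ 2 + fps_const d"
proof -
  \<comment> \<open>Convergence at the boundary point 1 gives radius of convergence at least
    1.\<close>
  have "summable (\<lambda>l. fps_nth W l * 1 ^ l)" using sums[of 1] by (auto simp: sums_iff)
  from conv_radius_geI[OF this] have W1: "1 \<le> fps_conv_radius W"
    by (simp add: fps_conv_radius_def one_ereal_def)
  have small: "ereal (cmod x) < fps_conv_radius W" if "cmod x < 1" for x
    by (rule less_le_trans[OF _ W1]) (use that in \<open>simp add: one_ereal_def\<close>)
  have ev: "eval_fps W x = p x" if "cmod x \<le> 1" for x
    using sums[OF that] by (simp add: eval_fps_def sums_iff)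
  have pos: "0 < fps_conv_radius W" by (rule less_le_trans[OF _ W1]) simp
  define F1 where "F1 = (fps_const A - fps_const t * fps_X) * W"
  define F2 where "F2 = fps_const c * (W * W) + fps_const d"
  have rad_lin: "fps_conv_radius (fps_const A - fps_const t * fps_X) = \<infinity>"
    using fps_conv_radius_diff[of "fps_const A" "fps_const t * fps_X"] fps_conv_radius_mult[of "fps_const t" fps_X] by simp
  have rad_X: "fps_conv_radius (fps_const t * fps_X) = \<infinity>"
    using fps_conv_radius_mult[of "fps_const t" fps_X] by simp
  have lin: "eval_fps (fps_const A - fps_const t * fps_X) x = A - t * x" for x
    using rad_X by (simp add: eval_fps_diff eval_fps_mult)
  have rad1: "fps_conv_radius W \<le> fps_conv_radius F1"
    unfolding F1_def using fps_conv_radius_mult[of "fps_const A - fps_const t * fps_X" W] rad_lin by simp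
  have rad2': "fps_conv_radius W \<le> fps_conv_radius (W * W)"
    using fps_conv_radius_mult[of W W] by simp
  have rad2: "fps_conv_radius W \<le> fps_conv_radius F2"
    unfolding F2_def
    using order.trans[OF rad2' fps_conv_radius_mult[of "fps_const c" "W * W", simplified]]
      fps_conv_radius_add[of "fps_const c * (W * W)" "fps_const d"] by simp
  have "F1 = F2"
  proof (rule eval_fps_eqD)
    show "0 < fps_conv_radius F1" "0 < fps_conv_radius F2" using pos rad1 rad2 by auto
    have "eventually (\<lambda>x. x \<in> ball (0::complex) 1) (nhds 0)"
      by (rule eventually_nhds_in_open) auto
    thus "eventually (\<lambda>x. eval_fps F1 x = eval_fps F2 x) (nhds 0)"
    proof eventually_elim
      case (elim x)
      hence x: "cmod x < 1" by simp
      have "eval_fps F1 x = (A - t * x) * eval_fps W x"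
        unfolding F1_def using small[OF x] rad_lin
        by (subst eval_fps_mult) (auto simp: lin)
      moreover have "eval_fps F2 x = c * (eval_fps W x * eval_fps W x) + d"
        unfolding F2_def using small[OF x] rad2' fps_conv_radius_mult[of "fps_const c" "W * W"]
        by (subst eval_fps_add) (auto simp: eval_fps_mult)
      ultimately show ?case using quad[of x] ev[of x] x by (simp add: power2_eq_square)
    qed
  qed
  thus ?thesis by (simp add: F1_def F2_def power2_eq_square left_diff_distrib mult.assoc)
qed

section \<open>The rates of the two queues\<close>

lemma jump_chainI:
  fixes q :: "'b :: {countable, t2_space} \<Rightarrow> 'b \<Rightarrow> real"
  assumes "jump_chain_law q M Y T z" "\<And>x :: 'b. open {x}" "\<And>x y. 0 \<le> q x y" "\<And>x. q x x = 0"
    "\<And>x. finite {y. q x y \<noteq> 0}" "\<And>x. 0 < qout q x" "\<And>x. qout q x \<le> C"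
  shows "jump_chain M q C z Y T"
proof -
  interpret prob_space M using assms(1) by (simp add: jump_chain_law_def)
  show ?thesis by unfold_locales (use assms in auto)
qed

lemma succs_rateMM1:
  assumes "0 < l" "0 < m"
  shows "{k. rateMM1 l m n k \<noteq> 0} = (if n = 0 then {1} else {n + 1, n - 1})"
  using assms by (auto simp: rateMM1_def split: if_splits)

lemma finite_rateMM1:
  assumes "0 < l" "0 < m"
  shows "finite {k. rateMM1 l m n k \<noteq> 0}"
  unfolding succs_rateMM1[OF assms] by simp

lemma sum_rateMM1:
  fixes f :: "nat \<Rightarrow> 'c :: real_algebra_1"
  assumes "0 < l" "0 < m"
  shows "(\<Sum>k | rateMM1 l m n k \<noteq> 0. of_real (rateMM1 l m n k) * f k) =
    of_real l * f (n + 1) + (if n = 0 then 0 else of_real m * f (n - 1))"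
  unfolding succs_rateMM1[OF assms] by (auto simp: rateMM1_def)

lemma qout_rateMM1:
  assumes "0 < l" "0 < m"
  shows "qout (rateMM1 l m) n = l + (if n = 0 then 0 else m)"
proof -
  have "qout (rateMM1 l m) n = (\<Sum>k | rateMM1 l m n k \<noteq> 0. of_real (rateMM1 l m n k) * 1)"
    by (subst qout_eq_sum_support[OF _ finite_rateMM1[OF assms]]) (simp_all add: rateMM1_def)
  also have "\<dots> = l + (if n = 0 then 0 else m)" by (subst sum_rateMM1[OF assms]) auto
  finally show ?thesis .
qed

lemma succs_rateX:
  assumes "0 < l1" "0 < l2" "0 < m1" "0 < m2"
  shows "{y. rateX l1 l2 m1 m2 (i, j) y \<noteq> 0} =
    {(i + 1, j), (i, j + 1)} \<union> (if j = 0 then if i = 0 then {} else {(i - 1, 0)} else {(i, j - 1)})"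
  using assms by (auto simp: rateX_def split: if_splits)

lemma finite_rateX:
  assumes "0 < l1" "0 < l2" "0 < m1" "0 < m2"
  shows "finite {y. rateX l1 l2 m1 m2 x y \<noteq> 0}"
  by (cases x) (simp only: succs_rateX[OF assms], simp)

lemma sum_rateX:
  fixes f :: "nat \<times> nat \<Rightarrow> 'c :: real_algebra_1"
  assumes "0 < l1" "0 < l2" "0 < m1" "0 < m2"
  shows "(\<Sum>y | rateX l1 l2 m1 m2 (i, j) y \<noteq> 0. of_real (rateX l1 l2 m1 m2 (i, j) y) * f y) =
    of_real l1 * f (i + 1, j) + of_real l2 * f (i, j + 1) +
    (if j = 0 then if i = 0 then 0 else of_real m1 * f (i - 1, 0) else of_real m2 * f (i, j - 1))"
  unfolding succs_rateX[OF assms] by (auto simp: rateX_def)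

lemma qout_rateX:
  assumes "0 < l1" "0 < l2" "0 < m1" "0 < m2"
  shows "qout (rateX l1 l2 m1 m2) (i, j) = l1 + l2 + (if j = 0 then if i = 0 then 0 else m1 else m2)"
proof -
  have "qout (rateX l1 l2 m1 m2) (i, j) = (\<Sum>y | rateX l1 l2 m1 m2 (i, j) y \<noteq> 0. of_real (rateX l1 l2 m1 m2 (i, j) y) * 1)"
    by (subst qout_eq_sum_support[OF _ finite_rateX[OF assms]]) (auto simp: rateX_def)
  also have "\<dots> = l1 + l2 + (if j = 0 then if i = 0 then 0 else m1 else m2)"
    by (subst sum_rateX[OF assms]) auto
  finally show ?thesis .
qed

lemma jump_chain_rateMM1:
  assumes "0 < l" "0 < m" "jump_chain_law (rateMM1 l m) M Y T z"
  shows "jump_chain M (rateMM1 l m) (l + m) z Y T"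
proof (rule jump_chainI[OF assms(3)])
  show "finite {k. rateMM1 l m n k \<noteq> 0}" for n
    by (rule finite_rateMM1[OF assms(1,2)])
  show "open {n}" for n :: nat by (rule discrete_topology_class.open_discrete)
qed (use assms in \<open>auto simp: qout_rateMM1 rateMM1_def\<close>)

lemma jump_chain_rateX:
  assumes pos: "0 < l1" "0 < l2" "0 < m1" "0 < m2" and law: "jump_chain_law (rateX l1 l2 m1 m2) M Y T z"
  shows "jump_chain M (rateX l1 l2 m1 m2) (l1 + l2 + m1 + m2) z Y T"
proof (rule jump_chainI[OF law])
  fix x y :: "nat \<times> nat"
  have "open ({fst x} \<times> {snd x})" by (intro open_Times discrete_topology_class.open_discrete)
  thus "open {x}" by simp
  show "0 \<le> rateX l1 l2 m1 m2 x y" "rateX l1 l2 m1 m2 x x = 0"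
    using pos by (auto simp: rateX_def split: prod.splits)
  show "finite {y. rateX l1 l2 m1 m2 x y \<noteq> 0}"
    by (rule finite_rateX[OF pos])
  show "0 < qout (rateX l1 l2 m1 m2) x" "qout (rateX l1 l2 m1 m2) x \<le> l1 + l2 + m1 + m2"
    using pos by (cases x; auto simp: qout_rateX[OF pos])+
qed

section \<open>The busy period\<close>

locale busy_period =
  fixes l m :: real and M :: "'a measure" and Y :: "nat \<Rightarrow> 'a \<Rightarrow> nat" and T :: "nat \<Rightarrow> 'a \<Rightarrow> real"
  assumes l_pos: "0 < l" and m_pos: "0 < m" and law1: "jump_chain_law (rateMM1 l m) M Y T 1"
begin

sublocale jump_chain M "rateMM1 l m" "l + m" 1 Y T
  by (rule jump_chain_rateMM1[OF l_pos m_pos law1])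

text \<open>The function \<open>p ^ n\<close> is bounded since \<open>cmod p \<le> 1\<close>, equals
  1 at the target 0, and for positive \<open>n\<close> its resolvent equation is
  \<open>p ^ (n - 1)\<close> times the quadratic equation.\<close>

lemma busy_period_transform:
  assumes s: "0 < Re s"
  shows "expectation (\<lambda>\<omega>. disc s (hit_time Y T {0} \<omega>)) = phi l m s"
proof -
  define p where "p = phi l m s"
  have p: "cmod p \<le> 1" unfolding p_def by (rule cmod_phi_le_1[OF l_pos m_pos s])
  have quad: "of_real l * p ^ 2 + of_real m = (of_real l + of_real m + s) * p"
    unfolding p_def using l_pos by (intro phi_quadratic) auto
  have "expectation (\<lambda>\<omega>. disc s (hit_time Y T {0} \<omega>)) = p ^ 1"
  proof (rule exit_transform[where D = "{1..}" and B = 1 and f = "\<lambda>n. p ^ n", OF s])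
    fix n :: nat assume "n \<in> {1..}"
    then obtain k where k: "n = Suc k" by (cases n) auto
    have "resolvent_op s (\<lambda>n. p ^ n) n =
      (s + of_real l + of_real m) * p ^ n - (of_real l * p ^ (n + 1) + of_real m * p ^ (n - 1))"
      unfolding resolvent_op_def succs_def sum_rateMM1[OF l_pos m_pos] qout_rateMM1[OF l_pos m_pos]
      using k by simp
    also have "\<dots> = p ^ k * ((of_real l + of_real m + s) * p - (of_real l * p ^ 2 + of_real m))"
      by (simp add: k power2_eq_square algebra_simps)
    finally show "resolvent_op s (\<lambda>n. p ^ n) n = 0" by (simp add: quad)
  qed (use p in \<open>auto simp: norm_power power_le_one\<close>)
  thus ?thesis by (simp add: p_def)
qed

lemma measurable_hit_time_0 [measurable]: "hit_time Y T {0} \<in> borel_measurable M"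
  by (rule measurable_hit_time')

section \<open>Poisson arrivals counted during the busy period\<close>

context
  fixes \<alpha> :: complex and \<theta> :: real
  assumes \<alpha>: "0 < Re \<alpha>" and \<theta>: "0 \<le> \<theta>"
begin

definition count_term :: "nat \<Rightarrow> 'a \<Rightarrow> complex" where
  "count_term k \<omega> = disc \<alpha> (hit_time Y T {0} \<omega>) *
     of_real (exp (- \<theta> * real_of_ereal (hit_time Y T {0} \<omega>)) * (\<theta> * real_of_ereal (hit_time Y T {0} \<omega>)) ^ k / fact k)"

lemma wB_eq: "wB M Y T \<theta> k \<alpha> = expectation (count_term k)"
  unfolding wB_def count_term_def[abs_def] Let_def ..

lemma measurable_count_term [measurable]: "count_term k \<in> borel_measurable M"
  unfolding count_term_def disc_def by measurable

text \<open>Poisson probabilities sum to 1, which gives a constant dominating all partial sums at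
  every sample point.\<close>

lemma sum_cmod_count_term_le_1: "(\<Sum>k<K. cmod (count_term k \<omega>)) \<le> 1"
proof -
  define b where "b = \<theta> * real_of_ereal (hit_time Y T {0} \<omega>)"
  have b: "0 \<le> b" using \<theta> hit_time_nonneg[of Y T "{0}" \<omega>] by (simp add: b_def real_of_ereal_pos)
  have d: "cmod (disc \<alpha> (hit_time Y T {0} \<omega>)) \<le> 1"
    using \<alpha> hit_time_nonneg[of Y T "{0}" \<omega>]
    by (cases "hit_time Y T {0} \<omega>") (auto simp: disc_def norm_exp_eq_Re)
  have "count_term k \<omega> = disc \<alpha> (hit_time Y T {0} \<omega>) * of_real (exp (- b) * b ^ k / fact k)" for k
    by (simp add: count_term_def b_def)
  hence "cmod (count_term k \<omega>) = cmod (disc \<alpha> (hit_time Y T {0} \<omega>)) * exp (- b) * (b ^ k /\<^sub>R fact k)" for k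
    unfolding norm_mult norm_of_real using b by (simp add: divide_inverse mult_ac norm_mult del: of_real_mult of_real_divide of_real_power)
  hence "(\<Sum>k<K. cmod (count_term k \<omega>)) = cmod (disc \<alpha> (hit_time Y T {0} \<omega>)) * exp (- b) * (\<Sum>k<K. b ^ k /\<^sub>R fact k)"
    unfolding sum_distrib_left by (intro sum.cong) auto
  also have "\<dots> \<le> 1 * exp (- b) * exp b"
  proof (intro mult_mono d)
    show "(\<Sum>k<K. b ^ k /\<^sub>R fact k) \<le> exp b"
      unfolding sums_unique[OF exp_converges[of b]]
      by (rule sum_le_suminf[OF sums_summable[OF exp_converges]]) (use b in auto)
  qed (use b in \<open>auto intro!: sum_nonneg\<close>)
  also have "\<dots> = 1" by (simp add: exp_minus)
  finally show ?thesis .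
qed

lemma integrable_count_term: "integrable M (count_term k)"
proof (rule integrable_const_bound[where B = 1])
  show "AE \<omega> in M. cmod (count_term k \<omega>) \<le> 1"
  proof (rule AE_I2)
    fix \<omega>
    have "cmod (count_term k \<omega>) \<le> (\<Sum>k<Suc k. cmod (count_term k \<omega>))" by (simp add: sum_nonneg)
    thus "cmod (count_term k \<omega>) \<le> 1" using sum_cmod_count_term_le_1 by (rule order.trans)
  qed
qed measurable

lemma sum_cmod_wB_le_1: "(\<Sum>k<K. cmod (wB M Y T \<theta> k \<alpha>)) \<le> 1"
proof -
  have "(\<Sum>k<K. cmod (wB M Y T \<theta> k \<alpha>)) \<le> (\<Sum>k<K. expectation (\<lambda>\<omega>. cmod (count_term k \<omega>)))"
    unfolding wB_eq by (intro sum_mono integral_norm_bound)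
  also have "\<dots> = expectation (\<lambda>\<omega>. \<Sum>k<K. cmod (count_term k \<omega>))"
    by (rule Bochner_Integration.integral_sum[symmetric]) (intro integrable_norm integrable_count_term)
  also have "\<dots> \<le> expectation (\<lambda>_. 1)"
    by (rule integral_mono') (auto simp: sum_cmod_count_term_le_1)
  finally show ?thesis by (simp add: prob_space)
qed

text \<open>The generating function of the Poisson law shifts the transform argument by
  \<open>\<theta> * (1 - x)\<close>. For an infinite busy period both sides vanish through
  \<open>disc\<close>.\<close>

lemma count_term_sums:
  "(\<lambda>k. count_term k \<omega> * x ^ k) sums disc (of_real \<theta> * (1 - x) + \<alpha>) (hit_time Y T {0} \<omega>)"
proof (cases "hit_time Y T {0} \<omega>")
  case (real b)
  have "(\<lambda>k. exp (- \<alpha> * of_real b) * exp (- of_real (\<theta> * b)) * ((of_real (\<theta> * b) * x) ^ k /\<^sub>R fact k)) sums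
     (exp (- \<alpha> * of_real b) * exp (- of_real (\<theta> * b)) * exp (of_real (\<theta> * b) * x))"
    by (intro sums_mult exp_converges)
  moreover have "exp (- \<alpha> * of_real b) * exp (- of_real (\<theta> * b)) * exp (of_real (\<theta> * b) * x) =
      disc (of_real \<theta> * (1 - x) + \<alpha>) (hit_time Y T {0} \<omega>)"
    by (simp add: disc_def real algebra_simps flip: exp_add)
  moreover have "exp (- \<alpha> * of_real b) * exp (- of_real (\<theta> * b)) * ((of_real (\<theta> * b) * x) ^ k /\<^sub>R fact k) = count_term k \<omega> * x ^ k" for k
    by (simp add: count_term_def disc_def real power_mult_distrib scaleR_conv_of_real divide_inverse mult_ac exp_of_real[symmetric])
  ultimately show ?thesis by simp
qed (use hit_time_nonneg[of Y T "{0}" \<omega>] in \<open>auto simp: count_term_def disc_def\<close>)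

text \<open>The boundary of the disc is included because \<open>g\<close> is only known to satisfy
  \<open>cmod g \<le> 1\<close>.\<close>

lemma wB_sums:
  assumes x: "cmod x \<le> 1"
  shows "(\<lambda>k. wB M Y T \<theta> k \<alpha> * x ^ k) sums phi l m (of_real \<theta> * (1 - x) + \<alpha>)"
proof -
  have "Re x \<le> 1" using complex_Re_le_cmod[of x] x by simp
  hence "0 \<le> \<theta> * (1 - Re x)" using \<theta> by simp
  hence s: "0 < Re (of_real \<theta> * (1 - x) + \<alpha>)" using \<alpha> by simp
  have "(\<lambda>K. expectation (\<lambda>\<omega>. \<Sum>k<K. count_term k \<omega> * x ^ k)) \<longlonglongrightarrow>
      expectation (\<lambda>\<omega>. disc (of_real \<theta> * (1 - x) + \<alpha>) (hit_time Y T {0} \<omega>))"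
  proof (rule integral_dominated_convergence[where w = "\<lambda>_. 1"])
    show "AE \<omega> in M. (\<lambda>K. \<Sum>k<K. count_term k \<omega> * x ^ k) \<longlonglongrightarrow> disc (of_real \<theta> * (1 - x) + \<alpha>) (hit_time Y T {0} \<omega>)"
      using count_term_sums by (auto simp: sums_def)
    show "AE \<omega> in M. cmod (\<Sum>k<K. count_term k \<omega> * x ^ k) \<le> 1" for K
    proof (rule AE_I2)
      fix \<omega>
      have "cmod (\<Sum>k<K. count_term k \<omega> * x ^ k) \<le> (\<Sum>k<K. cmod (count_term k \<omega>))"
        using x by (intro sum_norm_le) (auto simp: norm_mult norm_power power_le_one mult_left_le)
      thus "cmod (\<Sum>k<K. count_term k \<omega> * x ^ k) \<le> 1"
        using sum_cmod_count_term_le_1 by (rule order.trans)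
    qed
    show "(\<lambda>\<omega>. disc (of_real \<theta> * (1 - x) + \<alpha>) (hit_time Y T {0} \<omega>)) \<in> borel_measurable M"
      unfolding disc_def by measurable
  qed auto
  also have "(\<lambda>K. expectation (\<lambda>\<omega>. \<Sum>k<K. count_term k \<omega> * x ^ k)) = (\<lambda>K. \<Sum>k<K. wB M Y T \<theta> k \<alpha> * x ^ k)"
    by (subst Bochner_Integration.integral_sum) (auto simp: wB_eq integrable_count_term)
  finally show ?thesis by (simp add: sums_def busy_period_transform[OF s])
qed

end

end

section \<open>The priority queue\<close>

locale priority_queue =
  fixes l1 l2 m1 m2 :: real and M :: "nat \<times> nat \<Rightarrow> 'a measure"
    and Y :: "nat \<Rightarrow> 'a \<Rightarrow> nat \<times> nat" and T :: "nat \<Rightarrow> 'a \<Rightarrow> real" and \<alpha> g :: complex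
  assumes pos: "0 < l1" "0 < l2" "0 < m1" "0 < m2"
    and law: "\<And>z. jump_chain_law (rateX l1 l2 m1 m2) (M z) Y T z"
    and \<alpha>: "0 < Re \<alpha>"
    and g: "cmod g \<le> 1"
    and g_eq: "g * (\<alpha> + l1 + l2 + m1 - l1 * g - l2 * phi l2 m2 (of_real l1 * (1 - g) + \<alpha>)) = m1"
begin

sublocale Z: jump_chain "M z" "rateX l1 l2 m1 m2" "l1 + l2 + m1 + m2" z Y T for z
  by (rule jump_chain_rateX[OF pos law])

definition p :: complex where
  "p = phi l2 m2 (of_real l1 * (1 - g) + \<alpha>)"

lemma Re_shift_pos:
  assumes "cmod x \<le> 1"
  shows "0 < Re (of_real l1 * (1 - x) + \<alpha>)"
proof -
  have "Re x \<le> 1" using complex_Re_le_cmod[of x] assms by simp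
  hence "0 \<le> l1 * (1 - Re x)" using pos by simp
  thus ?thesis using \<alpha> by simp
qed

lemma p_le: "cmod p \<le> 1"
  unfolding p_def by (rule cmod_phi_le_1[OF pos(2,4) Re_shift_pos[OF g]])

lemma p_eq: "of_real l2 * p ^ 2 + of_real m2 = (of_real l2 + of_real m2 + of_real l1 * (1 - g) + \<alpha>) * p"
  using phi_quadratic[of l2 m2 "of_real l1 * (1 - g) + \<alpha>"] pos unfolding p_def by (simp add: add.assoc)

lemma g_eq': "g * (\<alpha> + l1 + l2 + m1 - l1 * g - l2 * p) = m1"
  using g_eq unfolding p_def .

lemma g_nonzero: "g \<noteq> 0"
  using g_eq pos by auto

lemma resolvent_op_rateX:
  "Z.resolvent_op a f (i, j) =
     (a + of_real l1 + of_real l2 + (if j = 0 then if i = 0 then 0 else of_real m1 else of_real m2)) * f (i, j) -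
     (of_real l1 * f (i + 1, j) + of_real l2 * f (i, j + 1) +
      (if j = 0 then if i = 0 then 0 else of_real m1 * f (i - 1, 0) else of_real m2 * f (i, j - 1)))"
  unfolding Z.resolvent_op_def Z.succs_def sum_rateX[OF pos] qout_rateX[OF pos] by simp

lemma succs_eq: "Z.succs (i, j) = {(i + 1, j), (i, j + 1)} \<union> (if j = 0 then if i = 0 then {} else {(i - 1, 0)} else {(i, j - 1)})"
  unfolding Z.succs_def by (rule succs_rateX[OF pos])

text \<open>From \<open>(k, j)\<close> the chain first clears the class 2 customers (one factor \<open>p\<close> each, the class 1 arrivals
  meanwhile being weighted by \<open>g\<close>) and then descends along the axis (one factor \<open>g\<close> per step).\<close>

definition descent :: "complex \<Rightarrow> nat \<times> nat \<Rightarrow> complex" where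
  "descent c x = (if fst x = 0 then 0 else c * g ^ (fst x - 1) * p ^ snd x)"

lemma cmod_descent_le: "cmod (descent c x) \<le> cmod c"
proof -
  have "cmod (g ^ (fst x - 1)) * cmod (p ^ snd x) \<le> 1 * 1"
    using g p_le by (intro mult_mono) (auto simp: norm_power power_le_one)
  thus ?thesis unfolding descent_def by (auto simp: norm_mult mult.assoc mult_left_le)
qed

lemma resolvent_descent_1: "Z.resolvent_op \<alpha> (descent c) (1, 0) = c * (\<alpha> + l1 + l2 + m1 - l1 * g - l2 * p)"
  by (simp add: resolvent_op_rateX descent_def algebra_simps)

text \<open>On the axis the fixed point equation of \<open>g\<close> factors out, off the axis the
  quadratic equation of \<open>p\<close>. The state \<open>(1, 0)\<close> is exceptional because
  \<open>descent\<close> is 0 at \<open>(0, 0)\<close>, so the term with \<open>m1\<close> is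
  missing there.\<close>

lemma resolvent_descent_eq_0:
  assumes "1 \<le> k" "(k, j) \<noteq> (1, 0)"
  shows "Z.resolvent_op \<alpha> (descent c) (k, j) = 0"
proof (cases j)
  case 0
  then obtain n where k: "k = Suc (Suc n)" using assms by (cases k; cases "k - 1") auto
  have "Z.resolvent_op \<alpha> (descent c) (k, j) = c * g ^ n * (g * (\<alpha> + l1 + l2 + m1 - l1 * g - l2 * p) - m1)"
    by (simp add: resolvent_op_rateX descent_def k 0 algebra_simps)
  thus ?thesis by (simp add: g_eq')
next
  case (Suc i)
  from assms obtain n where k: "k = Suc n" by (cases k) auto
  have "Z.resolvent_op \<alpha> (descent c) (k, j) = c * g ^ n * p ^ i *
      ((of_real l2 + of_real m2 + of_real l1 * (1 - g) + \<alpha>) * p - (of_real l2 * p ^ 2 + of_real m2))"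
    by (simp add: resolvent_op_rateX descent_def k Suc algebra_simps power2_eq_square)
  thus ?thesis by (simp add: p_eq)
qed

text \<open>Class 1 is served on the axis only, so the first coordinate can drop from 2 to 1 only by
  entering \<open>(1, 0)\<close>.\<close>

lemma GX_eq: "GX (M (2, 0)) Y T \<alpha> = g"
proof -
  have "Z.expectation (2, 0) (\<lambda>\<omega>. disc \<alpha> (hit_time Y T {(1, 0)} \<omega>)) = descent 1 (2, 0)"
  proof (rule Z.exit_transform[where D = "{x. 2 \<le> fst x}" and B = 1, OF \<alpha>])
    show "cmod (descent 1 x) \<le> 1" for x using cmod_descent_le[of 1 x] by simp
    show "Z.resolvent_op \<alpha> (descent 1) x = 0" if "x \<in> {x. 2 \<le> fst x}" for x
      using that by (cases x) (auto intro!: resolvent_descent_eq_0)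
    show "y \<in> {(1, 0)}" if "x \<in> {x. 2 \<le> fst x}" "y \<in> Z.succs x" "y \<notin> {x. 2 \<le> fst x}" for x y
      using that by (cases x) (auto simp: succs_eq split: if_splits)
  qed (auto simp: descent_def)
  thus ?thesis by (simp add: GX_def descent_def)
qed

text \<open>The factor \<open>g / m1\<close> is the inverse of the bracket in the equation of
  \<open>g\<close>; it normalises the source at \<open>(1, 0)\<close> to 1.\<close>

lemma NX_eq: "NX (M (1, 0)) Y T \<alpha> = g / m1"
proof -
  define h where "h x = (if x = (1, 0) then 1 else 0 :: complex)" for x :: "nat \<times> nat"
  have "descent (g / m1) (1, 0) = Z.expectation (1, 0) (Z.occupation {(0, 0)} h \<alpha>) +
      0 * Z.expectation (1, 0) (\<lambda>\<omega>. disc \<alpha> (hit_time Y T {(0, 0)} \<omega>))"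
  proof (rule Z.dynkin_formula[where D = "{x. 1 \<le> fst x}" and B' = 1, OF \<alpha> cmod_descent_le])
    show "Z.resolvent_op \<alpha> (descent (g / m1)) x = h x" if "x \<in> {x. 1 \<le> fst x}" for x
    proof (cases "x = (1, 0)")
      case True
      have "Z.resolvent_op \<alpha> (descent (g / m1)) (1, 0) = (g * (\<alpha> + l1 + l2 + m1 - l1 * g - l2 * p)) / m1"
        unfolding resolvent_descent_1 by simp
      also have "\<dots> = 1" unfolding g_eq' using pos by simp
      finally show ?thesis using True by (simp add: h_def)
    next
      case False
      with that show ?thesis by (cases x) (auto intro!: resolvent_descent_eq_0 simp: h_def)
    qed
    show "y \<in> {(0, 0)}" if "x \<in> {x. 1 \<le> fst x}" "y \<in> Z.succs x" "y \<notin> {x. 1 \<le> fst x}" for x y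
      using that by (cases x) (auto simp: succs_eq split: if_splits)
  qed (auto simp: descent_def h_def)
  thus ?thesis by (simp add: NX_def Z.occupation_def[abs_def] h_def descent_def)
qed

end

section \<open>Successive class 2 busy periods with class 1 arrivals\<close>

locale priority_queue_busy = priority_queue l1 l2 m1 m2 M Y T \<alpha> g + busy_period l2 m2 M' Y' T'
  for l1 l2 m1 m2 :: real and M :: "nat \<times> nat \<Rightarrow> 'a measure"
    and Y :: "nat \<Rightarrow> 'a \<Rightarrow> nat \<times> nat" and T :: "nat \<Rightarrow> 'a \<Rightarrow> real" and \<alpha> g :: complex
    and M' :: "'b measure" and Y' :: "nat \<Rightarrow> 'b \<Rightarrow> nat" and T' :: "nat \<Rightarrow> 'b \<Rightarrow> real"
begin

definition w :: "nat \<Rightarrow> complex" where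
  "w k = wB M' Y' T' l1 k \<alpha>"

definition W :: "complex fps" where
  "W = Abs_fps w"

lemma l1_nonneg: "0 \<le> l1" using pos by simp

lemma w_sums: "cmod x \<le> 1 \<Longrightarrow> (\<lambda>k. w k * x ^ k) sums phi l2 m2 (of_real l1 * (1 - x) + \<alpha>)"
  unfolding w_def by (rule wB_sums[OF \<alpha> l1_nonneg])

lemma W_quadratic:
  "fps_const (\<alpha> + l1 + l2 + m2) * W - fps_const (of_real l1) * fps_X * W = fps_const (of_real l2) * W ^ 2 + fps_const (of_real m2)"
proof (rule fps_eq_if_powser_quadratic)
  fix x :: complex assume x: "cmod x \<le> 1"
  show "(\<lambda>l. fps_nth W l * x ^ l) sums phi l2 m2 (of_real l1 * (1 - x) + \<alpha>)"
    using w_sums[OF x] by (simp add: W_def)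
  show "of_real l2 * phi l2 m2 (of_real l1 * (1 - x) + \<alpha>) ^ 2 + of_real m2 =
      (\<alpha> + l1 + l2 + m2 - of_real l1 * x) * phi l2 m2 (of_real l1 * (1 - x) + \<alpha>)"
    using phi_quadratic[of l2 m2 "of_real l1 * (1 - x) + \<alpha>"] pos by (simp add: algebra_simps)
qed

text \<open>The discounted weight of clearing \<open>j\<close> class 2 customers while exactly
  \<open>k\<close> class 1 customers arrive, as a \<open>j\<close>-fold convolution of
  \<open>w\<close>.\<close>

definition V :: "nat \<Rightarrow> nat \<Rightarrow> complex" where
  "V j k = fps_nth (W ^ j) k"

lemma V_0: "V 0 k = (if k = 0 then 1 else 0)"
  by (simp add: V_def)

lemma V_1: "V (Suc 0) k = w k"
  by (simp add: V_def W_def)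

text \<open>The coefficient of order \<open>k\<close> in the quadratic equation of \<open>W\<close>
  multiplied by \<open>W ^ j\<close>; the factor \<open>fps_X\<close> stands for a class 1
  arrival.\<close>

lemma V_rec:
  "(\<alpha> + l1 + l2 + m2) * V (Suc j) k - of_real l1 * (if k = 0 then 0 else V (Suc j) (k - 1)) =
     of_real l2 * V (Suc (Suc j)) k + of_real m2 * V j k"
proof -
  have "fps_const (\<alpha> + l1 + l2 + m2) * W ^ Suc j - fps_const (of_real l1) * (fps_X * W ^ Suc j) =
      (fps_const (\<alpha> + l1 + l2 + m2) * W - fps_const (of_real l1) * fps_X * W) * W ^ j"
    by (simp add: algebra_simps)
  also have "\<dots> = fps_const (of_real l2) * W ^ Suc (Suc j) + fps_const (of_real m2) * W ^ j"
    unfolding W_quadratic by (simp add: algebra_simps power2_eq_square)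
  finally have "fps_nth (fps_const (\<alpha> + l1 + l2 + m2) * W ^ Suc j - fps_const (of_real l1) * (fps_X * W ^ Suc j)) k =
     fps_nth (fps_const (of_real l2) * W ^ Suc (Suc j) + fps_const (of_real m2) * W ^ j) k"
    by (rule arg_cong)
  thus ?thesis by (cases k) (simp_all add: V_def del: power_Suc)
qed

lemma sum_cmod_V_le_1: "(\<Sum>k<K. cmod (V j k)) \<le> 1"
  unfolding V_def
  by (rule fps_nth_power_abs_sum_le_1) (simp add: W_def w_def sum_cmod_wB_le_1[OF \<alpha> l1_nonneg])

lemma summable_V: "summable (\<lambda>k. cmod (V j k))"
proof (rule bounded_imp_summable[where B = 1])
  show "(\<Sum>k\<le>n. cmod (V j k)) \<le> 1" for n
    using sum_cmod_V_le_1[of j "Suc n"] by (simp only: lessThan_Suc_atMost)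
qed simp

lemma suminf_V_le_1: "(\<Sum>k. cmod (V j k)) \<le> 1"
  by (rule suminf_le_const[OF summable_V sum_cmod_V_le_1])

section \<open>The excursion function and the recursion\<close>

definition c :: complex where
  "c = g / m1"

text \<open>Zero on the states that stop the excursion; from level \<open>k\<close> above them the
  path first descends \<open>k - (i + 1)\<close> levels and then spends the discounted time
  \<open>c\<close> in \<open>(i + 1, 0)\<close>.\<close>

definition axis :: "nat \<Rightarrow> nat \<Rightarrow> complex" where
  "axis i k = (if k \<le> i then 0 else c * g ^ (k - (i + 1)))"

lemma cmod_axis_le: "cmod (axis i k) \<le> cmod c"
proof -
  have "cmod c * cmod (g ^ (k - (i + 1))) \<le> cmod c * 1"
    using g by (intro mult_left_mono) (auto simp: norm_power power_le_one)
  thus ?thesis unfolding axis_def by (simp add: norm_mult)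
qed

text \<open>The discounted occupation time of \<open>(i + 1, 0)\<close> before the first visit to \<open>{(k, 0) | k \<le> i}\<close>.\<close>

definition excursion :: "nat \<Rightarrow> nat \<times> nat \<Rightarrow> complex" where
  "excursion i x = (\<Sum>k. V (snd x) k * axis i (fst x + k))"

lemma summable_cmod_V_axis: "summable (\<lambda>k. cmod (V j k * axis i (n + k)))"
proof (rule summable_comparison_test')
  show "summable (\<lambda>k. cmod (V j k) * cmod c)" by (rule summable_mult2[OF summable_V])
  show "norm (cmod (V j k * axis i (n + k))) \<le> cmod (V j k) * cmod c" for k
    unfolding norm_mult real_norm_def abs_mult abs_norm_cancel by (intro mult_left_mono cmod_axis_le norm_ge_zero)
qed

lemma excursion_sums: "(\<lambda>k. V j k * axis i (n + k)) sums excursion i (n, j)"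
  unfolding excursion_def using summable_norm_cancel[OF summable_cmod_V_axis] by (simp add: summable_sums)

lemma cmod_excursion_le: "cmod (excursion i x) \<le> cmod c"
proof -
  have "cmod (excursion i x) \<le> (\<Sum>k. cmod (V (snd x) k * axis i (fst x + k)))"
    unfolding excursion_def by (rule summable_norm[OF summable_cmod_V_axis])
  also have "\<dots> \<le> (\<Sum>k. cmod (V (snd x) k) * cmod c)"
    by (rule suminf_le[OF _ summable_cmod_V_axis summable_mult2[OF summable_V]])
       (unfold norm_mult, intro mult_left_mono cmod_axis_le norm_ge_zero)
  also have "\<dots> = (\<Sum>k. cmod (V (snd x) k)) * cmod c"
    by (rule suminf_mult2[symmetric, OF summable_V])
  also have "\<dots> \<le> 1 * cmod c" by (intro mult_right_mono suminf_V_le_1 norm_ge_zero)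
  finally show ?thesis by simp
qed

lemma excursion_axis: "excursion i (n, 0) = axis i n"
proof -
  have "(\<lambda>k. V 0 k * axis i (n + k)) sums axis i n"
    using sums_single[of 0 "\<lambda>k. axis i (n + k)"] by (simp add: V_0 if_distrib[of "\<lambda>x. x * _"] cong: if_cong)
  thus ?thesis using excursion_sums sums_unique2 by blast
qed

lemma resolvent_excursion_off_axis: "Z.resolvent_op \<alpha> (excursion i) (n, Suc j) = 0"
proof -
  \<comment> \<open>Shifting the index by one writes the series at level \<open>n + 1\<close> with
    the same factors \<open>axis i (n + k)\<close> as the others, so that \<open>V_rec\<close>
    cancels term by term.\<close>
  have "(\<lambda>k. if k = 0 then 0 else V (Suc j) (k - 1) * axis i (n + k)) sums excursion i (n + 1, Suc j)"
    using excursion_sums[of "Suc j" i "n + 1"] sums_Suc_iff[of "\<lambda>k. if k = 0 then 0 else V (Suc j) (k - 1) * axis i (n + k)"]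
    by simp
  hence "(\<lambda>k. (\<alpha> + l1 + l2 + m2) * (V (Suc j) k * axis i (n + k)) -
       of_real l1 * (if k = 0 then 0 else V (Suc j) (k - 1) * axis i (n + k)) -
       (of_real l2 * (V (Suc (Suc j)) k * axis i (n + k)) + of_real m2 * (V j k * axis i (n + k)))) sums
     ((\<alpha> + l1 + l2 + m2) * excursion i (n, Suc j) - of_real l1 * excursion i (n + 1, Suc j) -
       (of_real l2 * excursion i (n, Suc (Suc j)) + of_real m2 * excursion i (n, j)))"
    by (intro sums_diff sums_add sums_mult excursion_sums)
  moreover have "(\<alpha> + l1 + l2 + m2) * (V (Suc j) k * axis i (n + k)) -
       of_real l1 * (if k = 0 then 0 else V (Suc j) (k - 1) * axis i (n + k)) -
       (of_real l2 * (V (Suc (Suc j)) k * axis i (n + k)) + of_real m2 * (V j k * axis i (n + k))) = 0" for k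
  proof -
    have "(\<alpha> + l1 + l2 + m2) * (V (Suc j) k * axis i (n + k)) -
       of_real l1 * (if k = 0 then 0 else V (Suc j) (k - 1) * axis i (n + k)) -
       (of_real l2 * (V (Suc (Suc j)) k * axis i (n + k)) + of_real m2 * (V j k * axis i (n + k))) =
      (((\<alpha> + l1 + l2 + m2) * V (Suc j) k - of_real l1 * (if k = 0 then 0 else V (Suc j) (k - 1))) -
        (of_real l2 * V (Suc (Suc j)) k + of_real m2 * V j k)) * axis i (n + k)"
      by (simp add: algebra_simps)
    thus ?thesis by (simp only: V_rec) simp
  qed
  ultimately have "(\<alpha> + l1 + l2 + m2) * excursion i (n, Suc j) - of_real l1 * excursion i (n + 1, Suc j) -
       (of_real l2 * excursion i (n, Suc (Suc j)) + of_real m2 * excursion i (n, j)) = 0"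
    using sums_unique2[OF _ sums_zero] by (simp only:)
  thus ?thesis by (simp add: resolvent_op_rateX algebra_simps)
qed

lemma excursion_1_above:
  assumes "i < n"
  shows "excursion i (n, 1) = c * g ^ (n - (i + 1)) * p"
proof -
  have "(\<lambda>k. c * g ^ (n - (i + 1)) * (w k * g ^ k)) sums (c * g ^ (n - (i + 1)) * p)"
    unfolding p_def by (intro sums_mult w_sums g)
  moreover have "c * g ^ (n - (i + 1)) * (w k * g ^ k) = V 1 k * axis i (n + k)" for k
  proof -
    have "n + k - (i + 1) = (n - (i + 1)) + k" using assms by simp
    hence "axis i (n + k) = c * (g ^ (n - (i + 1)) * g ^ k)"
      using assms by (simp only: axis_def power_add) simp
    thus ?thesis by (simp add: V_1)
  qed
  ultimately show ?thesis using excursion_sums sums_unique2 by (simp only:) blast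
qed

text \<open>With at most \<open>i - n\<close> arrivals the busy period ends in a stopping state,
  where \<open>axis\<close> is 0. This removes the initial segment of the series of
  \<open>p\<close>, and the negative power of \<open>g\<close> accounts for the distance from
  \<open>n\<close> up to \<open>i + 1\<close>.\<close>

lemma excursion_1_below:
  assumes "n \<le> i"
  shows "excursion i (n, 1) = g powi (int n - int (i + 1)) * (p - (\<Sum>k = 0..i - n. w k * g ^ k)) * c"
proof -
  have "(\<lambda>k. w k * g ^ k - (if k \<in> {0..i - n} then w k * g ^ k else 0)) sums (p - (\<Sum>k = 0..i - n. w k * g ^ k))"
    unfolding p_def by (intro sums_diff w_sums g sums_If_finite_set) auto
  hence "(\<lambda>k. g powi (int n - int (i + 1)) * (w k * g ^ k - (if k \<in> {0..i - n} then w k * g ^ k else 0)) * c) sums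
     (g powi (int n - int (i + 1)) * (p - (\<Sum>k = 0..i - n. w k * g ^ k)) * c)"
    by (intro sums_mult sums_mult2)
  moreover have "g powi (int n - int (i + 1)) * (w k * g ^ k - (if k \<in> {0..i - n} then w k * g ^ k else 0)) * c =
     V 1 k * axis i (n + k)" for k
  proof (cases "k \<le> i - n")
    case True
    thus ?thesis using assms by (simp add: axis_def)
  next
    case False
    \<comment> \<open>The first exponent is negative; the sum is a natural number because
      \<open>k\<close> exceeds \<open>i - n\<close>.\<close>
    have "g powi (int n - int (i + 1)) * g ^ k = g powi (int n - int (i + 1) + int k)"
      using g_nonzero by (subst power_int_add) auto
    also have "int n - int (i + 1) + int k = int (n + k - (i + 1))" using False by simp
    finally have "g powi (int n - int (i + 1)) * g ^ k = g ^ (n + k - (i + 1))" by (simp only: power_int_of_nat)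
    thus ?thesis using False by (simp add: axis_def V_1 mult_ac)
  qed
  ultimately show ?thesis using excursion_sums sums_unique2 by (simp only:) blast
qed

lemma resolvent_excursion_above:
  assumes "i + 1 < n"
  shows "Z.resolvent_op \<alpha> (excursion i) (n, 0) = 0"
proof -
  obtain d where n: "n = i + 2 + d" using assms less_iff_Suc_add[of "i + 1" n] by auto
  have "excursion i (n, 1) = c * g ^ Suc d * p"
    using excursion_1_above[of i n] by (simp add: n)
  hence "Z.resolvent_op \<alpha> (excursion i) (n, 0) = c * g ^ d * (g * (\<alpha> + l1 + l2 + m1 - l1 * g - l2 * p) - m1)"
    by (simp add: resolvent_op_rateX excursion_axis axis_def n algebra_simps Suc_diff_le)
  thus ?thesis by (simp add: g_eq')
qed

lemma resolvent_excursion_source: "Z.resolvent_op \<alpha> (excursion i) (i + 1, 0) = 1"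
proof -
  have "Z.resolvent_op \<alpha> (excursion i) (i + 1, 0) = c * (\<alpha> + l1 + l2 + m1 - l1 * g - l2 * p)"
    using excursion_1_above[of i "i + 1"]
    by (simp add: resolvent_op_rateX excursion_axis axis_def algebra_simps)
  also have "\<dots> = (g * (\<alpha> + l1 + l2 + m1 - l1 * g - l2 * p)) / m1" by (simp add: c_def)
  also have "\<dots> = 1" unfolding g_eq' using pos by simp
  finally show ?thesis .
qed

text \<open>At a stopping state \<open>excursion\<close> vanishes there and at the axis state below,
  so the arrivals remain: class 1 contributes only from \<open>(i, 0)\<close>, where it leads to the
  value \<open>c\<close>, class 2 always. These defects, weighted by the transforms of the chain,
  form the right-hand side of the recursion.\<close>

lemma resolvent_excursion_below:
  assumes "n \<le> i"
  shows "Z.resolvent_op \<alpha> (excursion i) (n, 0) = - (of_real l1 * (if n = i then c else 0)) - of_real l2 * excursion i (n, 1)"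
proof -
  have "n - 1 \<le> i" using assms by simp
  with assms show ?thesis by (auto simp: resolvent_op_rateX excursion_axis axis_def)
qed

lemma laplace_recursion:
  "piX (M (0, 0)) Y T (i + 1, 0) \<alpha> = of_real l1 * piX (M (0, 0)) Y T (i, 0) \<alpha> * c +
     of_real l2 * (\<Sum>k = 0..i. piX (M (0, 0)) Y T (k, 0) \<alpha> * excursion i (k, 1))"
proof -
  define \<pi> where "\<pi> k = piX (M (0, 0)) Y T (k, 0) \<alpha>" for k
  define h where "h k = Z.resolvent_op \<alpha> (excursion i) (k, 0)" for k
  have "excursion i (0, 0) = (\<Sum>x\<in>(\<lambda>k. (k, 0)) ` {0..i + 1}. Z.resolvent_op \<alpha> (excursion i) x * Z.laplace_prob (0, 0) \<alpha> x)"
  proof (rule Z.resolvent_eq_sum_laplace_prob[where B = "cmod c", OF \<alpha> cmod_excursion_le])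
    fix x :: "nat \<times> nat" assume x: "x \<notin> (\<lambda>k. (k, 0)) ` {0..i + 1}"
    obtain k j where kj: "x = (k, j)" by (cases x)
    show "Z.resolvent_op \<alpha> (excursion i) x = 0"
    proof (cases j)
      case 0
      with x kj have "i + 1 < k" by (auto simp: image_iff)
      with 0 kj show ?thesis using resolvent_excursion_above by simp
    next
      case (Suc j')
      thus ?thesis using kj resolvent_excursion_off_axis by simp
    qed
  qed simp
  also have "\<dots> = (\<Sum>k = 0..i + 1. h k * \<pi> k)"
    by (subst sum.reindex) (auto simp: inj_on_def h_def \<pi>_def piX_def Z.laplace_prob_def)
  also have "\<dots> = (\<Sum>k = 0..i. h k * \<pi> k) + \<pi> (i + 1)"
    using resolvent_excursion_source[of i] by (simp add: h_def)
  also have "(\<Sum>k = 0..i. h k * \<pi> k) =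
     (\<Sum>k = 0..i. - (if k = i then of_real l1 * \<pi> i * c else 0) - of_real l2 * (\<pi> k * excursion i (k, 1)))"
    unfolding h_def by (rule sum.cong) (auto simp: resolvent_excursion_below algebra_simps)
  also have "\<dots> = - (of_real l1 * \<pi> i * c) - of_real l2 * (\<Sum>k = 0..i. \<pi> k * excursion i (k, 1))"
    by (simp add: sum_subtractf sum_negf sum_distrib_left)
  finally have "\<pi> (i + 1) = of_real l1 * \<pi> i * c + of_real l2 * (\<Sum>k = 0..i. \<pi> k * excursion i (k, 1))"
    by (simp add: excursion_axis axis_def algebra_simps)
  thus ?thesis unfolding \<pi>_def .
qed

end

theorem theorem5:
  fixes l1 l2 m1 m2 :: real and \<alpha> :: complex
    and M :: "nat \<times> nat \<Rightarrow> 'a measure" and Y :: "nat \<Rightarrow> 'a \<Rightarrow> nat \<times> nat" and T :: "nat \<Rightarrow> 'a \<Rightarrow> real"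
    and M' :: "'b measure" and Y' :: "nat \<Rightarrow> 'b \<Rightarrow> nat" and T' :: "nat \<Rightarrow> 'b \<Rightarrow> real"
  assumes "0 < l1" "0 < l2" "0 < m1" "0 < m2"
    and "0 < Re \<alpha>"
    and "\<forall>z. jump_chain_law (rateX l1 l2 m1 m2) (M z) Y T z"
    and "jump_chain_law (rateMM1 l2 m2) M' Y' T' 1"
  shows "\<forall>i::nat.
    piX (M (0,0)) Y T (i + 1, 0) \<alpha> =
      of_real l1 * piX (M (0,0)) Y T (i, 0) \<alpha> * NX (M (1,0)) Y T \<alpha>
    + of_real l2 * (\<Sum>k = 0..i. piX (M (0,0)) Y T (k, 0) \<alpha>
        * GX (M (2,0)) Y T \<alpha> powi (int k - int (i + 1))
        * (phi l2 m2 (of_real l1 * (1 - GX (M (2,0)) Y T \<alpha>) + \<alpha>)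
           - (\<Sum>l = 0..i - k. wB M' Y' T' l1 l \<alpha> * GX (M (2,0)) Y T \<alpha> ^ l))
        * NX (M (1,0)) Y T \<alpha>)"
proof -
  obtain g :: complex where g: "cmod g \<le> 1"
    "g * (\<alpha> + l1 + l2 + m1 - l1 * g - l2 * phi l2 m2 (of_real l1 * (1 - g) + \<alpha>)) = m1"
    by (rule exists_descent_transform[OF assms(1-5)])
  interpret priority_queue_busy l1 l2 m1 m2 M Y T \<alpha> g M' Y' T'
    using assms g by unfold_locales auto
  show ?thesis
  proof
    fix i
    have "piX (M (0,0)) Y T (k, 0) \<alpha> * excursion i (k, 1) = piX (M (0,0)) Y T (k, 0) \<alpha>
        * g powi (int k - int (i + 1))
        * (phi l2 m2 (of_real l1 * (1 - g) + \<alpha>) - (\<Sum>l = 0..i - k. wB M' Y' T' l1 l \<alpha> * g ^ l)) * c"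
      if "k \<in> {0..i}" for k
      using that by (simp only: excursion_1_below[of k i] atLeastAtMost_iff p_def w_def mult.assoc)
    hence sum_eq: "(\<Sum>k = 0..i. piX (M (0,0)) Y T (k, 0) \<alpha> * excursion i (k, 1)) =
      (\<Sum>k = 0..i. piX (M (0,0)) Y T (k, 0) \<alpha>
        * g powi (int k - int (i + 1))
        * (phi l2 m2 (of_real l1 * (1 - g) + \<alpha>) - (\<Sum>l = 0..i - k. wB M' Y' T' l1 l \<alpha> * g ^ l)) * c)"
      by (intro sum.cong) auto
    show "piX (M (0,0)) Y T (i + 1, 0) \<alpha> =
      of_real l1 * piX (M (0,0)) Y T (i, 0) \<alpha> * NX (M (1,0)) Y T \<alpha>
    + of_real l2 * (\<Sum>k = 0..i. piX (M (0,0)) Y T (k, 0) \<alpha>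
        * GX (M (2,0)) Y T \<alpha> powi (int k - int (i + 1))
        * (phi l2 m2 (of_real l1 * (1 - GX (M (2,0)) Y T \<alpha>) + \<alpha>)
           - (\<Sum>l = 0..i - k. wB M' Y' T' l1 l \<alpha> * GX (M (2,0)) Y T \<alpha> ^ l))
        * NX (M (1,0)) Y T \<alpha>)"
      unfolding GX_eq NX_eq c_def[symmetric] sum_eq[symmetric] by (rule laplace_recursion)
  qed
qed

end
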